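(* For every large enough $n$ and every $k\le O(n^{1/2}/\log n)$, there exist an unweighted graph $G=([n],E)$ with maximum degree $4$ whose Laplacian $L_G$ has condition number $\kappa(L_G)=O(k)$, and an edge $(u,v)\in E$, such that the following holds for some $\epsilon=\Theta(1/\log n)$. Every randomized algorithm that, given an input $b\in\mathbb{R}^n$ in the range of $L_G$ (accessed by probing coordinates), with probability at least $2/3$ approximates $x_u-x_v$ within additive error $\epsilon\|x^*\|_\infty$, for every solution $x^*\in\mathbb{R}^n$ of $L_Gx=b$ (here $x_u-x_v$ is the common value $x^*_u-x^*_v$ over all solutions), must probe $\tilde\Omega(k^2)$ coordinates of $b$ (in the worst case).
   Context: For a graph $G$ with adjacency matrix $A$ and diagonal degree matrix $D$, the Laplacian is $L_G=D-A$. For a PSD matrix $S$, the condition number $\kappa(S)$ is the ratio between its largest and smallest non-zero eigenvalues. The algorithm knows $G$, $u$, $v$ in advance (it may preprocess $G$); only probes to coordinates of $b$ are counted. $\tilde\Omega(\cdot)$ hides polylogarithmic factors in $n$. *)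

theory Defs
  imports
    "HOL-Probability.Probability"
    "Graph_Theory.Graph_Theory"
    "Jordan_Normal_Form.Spectral_Radius"
begin

(* Both the analysis library and the matrix library use $ for vector components;
   below it always means the latter. *)
unbundle no vec_syntax

text \<open>
  An unweighted (simple, undirected) graph on \<open>[n]\<close> is a \<^locale>\<open>pair_graph\<close> with vertex set
  \<open>{0..<n}\<close>.  Every undirected edge is represented by its two orientations, so the degree
  of a vertex is its out-degree.
\<close>

definition max_degree :: "'a pair_pre_digraph \<Rightarrow> nat" where
  "max_degree G = Max (out_degree (with_proj G) ` pverts G)"

definition adjacency_matrix :: "nat pair_pre_digraph \<Rightarrow> real mat" where
  "adjacency_matrix G =
     (let n = card (pverts G) in mat n n (\<lambda>(i, j). if (i, j) \<in> parcs G then 1 else 0))"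

definition degree_matrix :: "nat pair_pre_digraph \<Rightarrow> real mat" where
  "degree_matrix G = mat_diag (card (pverts G)) (\<lambda>i. real (out_degree (with_proj G) i))"

definition laplacian :: "nat pair_pre_digraph \<Rightarrow> real mat" where
  "laplacian G = degree_matrix G - adjacency_matrix G"

text \<open>Meant for non-zero PSD matrices, all of whose eigenvalues are real and non-negative.\<close>

definition condition_number :: "real mat \<Rightarrow> real" where
  "condition_number S = Max (spectrum S - {0}) / Min (spectrum S - {0})"

definition mat_range :: "real mat \<Rightarrow> real vec set" where
  "mat_range S = (\<lambda>x. S *\<^sub>v x) ` carrier_vec (dim_col S)"

definition linf_norm :: "real vec \<Rightarrow> real" where
  "linf_norm x = Max ((\<lambda>i. \<bar>x $ i\<bar>) ` {0..<dim_vec x})"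

text \<open>
  A deterministic adaptive algorithm with probe access to a vector is a decision tree: it either
  stops with an answer or probes a coordinate and continues depending on the value read.  There is
  no restriction on the computation made between probes.  Trees are well-founded, so every run
  terminates, but the number of probes need not be bounded over all inputs.
\<close>

datatype probe_alg = Answer real | Probe nat "real \<Rightarrow> probe_alg"

primrec answer :: "probe_alg \<Rightarrow> real vec \<Rightarrow> real" where
  "answer (Answer r) b = r"
| "answer (Probe i f) b = answer (f (b $ i)) b"

text \<open>The set of coordinates read on input \<open>b\<close>; reading a coordinate again is free.\<close>

primrec probed :: "probe_alg \<Rightarrow> real vec \<Rightarrow> nat set" where
  "probed (Answer r) b = {}"
| "probed (Probe i f) b = insert i (probed (f (b $ i)) b)"

text \<open>
  A randomized algorithm is a probability measure on deterministic algorithms, with an arbitrary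
  sigma-algebra: any family of decision trees indexed by the points of a probability space
  induces such a measure by push-forward.  The success event in \<open>solves_difference\<close> is implicitly
  required to be measurable, since non-measurable sets have \<^const>\<open>measure\<close> 0.
\<close>

definition solves_difference ::
  "real mat \<Rightarrow> nat \<Rightarrow> nat \<Rightarrow> real \<Rightarrow> probe_alg measure \<Rightarrow> bool" where
  "solves_difference L u v \<epsilon> R \<longleftrightarrow>
     (\<forall>b \<in> mat_range L. \<forall>x \<in> carrier_vec (dim_col L). L *\<^sub>v x = b \<longrightarrow>
        measure R {A \<in> space R. \<bar>answer A b - (x $ u - x $ v)\<bar> \<le> \<epsilon> * linf_norm x} \<ge> 2 / 3)"

text \<open>Worst case over inputs in the range of \<open>L\<close> and over all but a null set of the coins.\<close>

definition worst_case_probes_le :: "real mat \<Rightarrow> probe_alg measure \<Rightarrow> nat \<Rightarrow> bool" where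
  "worst_case_probes_le L R q \<longleftrightarrow>
     (\<forall>b \<in> mat_range L. AE A in R. card (probed A b) \<le> q)"

end

theory Submission
  imports Defs "HOL-Library.Discrete_Functions"
begin

text \<open>
  The graph consists of two copies of a heap-shaped forest: \<open>2^D\<close> complete binary trees with
  \<open>2^D\<close> leaves each, whose leaves are joined by the shuffle edges of a de Bruijn network.  The two
  copies of each root are joined by an edge.  A binary tree grounded at its root has spectral gap of
  order \<open>2^-D\<close>, and the de Bruijn network mixes the leaves in \<open>O(D)\<close> steps, so the condition
  number is \<open>2^D\<close> up to a power of \<open>D\<close>.

  The hard demands put independent signs on the \<open>4^D\<close> leaves of one copy and the opposite signs on
  the other; the potential is then antisymmetric and its drop across the edge at a root is twice its
  value there.  A bias \<open>\<delta>\<close> of the signs contributes \<open>\<delta> 2^D / 2\<close> to the potential of a root and at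
  most three times as much anywhere, whereas the noise is polynomial in \<open>D\<close>, because the rows of the
  Green function have Euclidean norm \<open>O(D^2)\<close>.  Hence for \<open>\<delta> = poly(D) / 2^D\<close> the answer
  reveals the sign of the bias, and finding it takes of the order of \<open>1 / \<delta>^2\<close> probes.  The
  degree 4 and a non-zero eigenvalue independent of \<open>D\<close> are supplied by a star on five further vertices; all
  remaining vertices are isolated.
\<close>

section \<open>Probing biased coins\<close>

text \<open>The shuffle edges are what turns \<open>k\<close> into \<open>k^2\<close>. Without them
  a root would see only the \<open>2^D\<close> leaves of its own tree: a signal of
  \<open>\<delta> 2^D / 2\<close> against noise of order \<open>2^(D/2)\<close> forces
  \<open>\<delta>\<close> up to about \<open>2^(-D/2)\<close>, worth only about \<open>2^D\<close>
  probes. With them the current from any leaf spreads over all \<open>2^D\<close> roots, so each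
  root averages all \<open>4^D\<close> signs and the noise drops to a power of \<open>D\<close>. The
  signal is unharmed, because the mean response is constant on levels and sends nothing through the
  shuffle edges. The two copies answer two demands of the problem at once: an admissible
  \<open>b\<close> must lie in the range of the Laplacian, and the quantity asked for is a
  difference across an edge. On antisymmetric functions the Laplacian acts as an invertible operator
  grounded at the roots, so every choice of signs is admissible, and the difference at a root edge
  is a single potential. Adaptive probing is handled by induction on the decision tree, tracking the
  likelihoods of the two biases; each newly read coin costs a factor
  \<open>1 - \<delta>\<^sup>2\<close> in their squared Hellinger affinity.\<close>

definition coin_sign :: "'a set \<Rightarrow> 'a \<Rightarrow> real" where
  "coin_sign S x = (if x \<in> S then 1 else - 1)"

text \<open>The probability that independent signs of mean \<open>\<delta>\<close>, one for each
  element of \<open>X\<close>, are positive exactly on \<open>S\<close>. Random demands stay finite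
  weighted sums over \<open>Pow X\<close>, so the only measure space is that of the algorithm's own
  coins.\<close>

definition coin_weight :: "real \<Rightarrow> 'a set \<Rightarrow> 'a set \<Rightarrow> real" where
  "coin_weight \<delta> X S = (\<Prod>x\<in>X. (1 + \<delta> * coin_sign S x) / 2)"

lemma coin_weight_nonneg: "\<bar>\<delta>\<bar> \<le> 1 \<Longrightarrow> coin_weight \<delta> X S \<ge> 0"
  unfolding coin_weight_def coin_sign_def by (intro prod_nonneg) auto

lemma sum_Pow_insert:
  fixes g :: "'a set \<Rightarrow> 'b::comm_monoid_add"
  assumes "finite U" "x \<notin> U"
  shows "(\<Sum>S\<in>Pow (insert x U). g S) = (\<Sum>S\<in>Pow U. g (insert x S)) + (\<Sum>S\<in>Pow U. g S)"
proof -
  have "inj_on (insert x) (Pow U)"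
    using assms(2) by (intro inj_onI) (metis Diff_insert_absorb PowD in_mono)
  moreover have "Pow U \<inter> insert x ` Pow U = {}"
    using assms(2) by auto
  ultimately show ?thesis
    using assms(1)
    by (simp add: Pow_insert sum.union_disjoint sum.reindex add.commute)
qed

text \<open>Independence: with the weights absorbed into \<open>\<phi>\<close>, the expectation of a
  product of functions of separate coins factorises.\<close>

lemma sum_Pow_prod:
  fixes \<phi> :: "'a \<Rightarrow> bool \<Rightarrow> 'b::comm_semiring_1"
  assumes "finite X"
  shows "(\<Sum>S\<in>Pow X. \<Prod>x\<in>X. \<phi> x (x \<in> S)) = (\<Prod>x\<in>X. \<phi> x True + \<phi> x False)"
  using assms
proof (induction X rule: finite_induct)
  case (insert y X)
  have "(\<Prod>x\<in>insert y X. \<phi> x (x \<in> insert y S)) = \<phi> y True * (\<Prod>x\<in>X. \<phi> x (x \<in> S))"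
       "(\<Prod>x\<in>insert y X. \<phi> x (x \<in> S)) = \<phi> y False * (\<Prod>x\<in>X. \<phi> x (x \<in> S))"
    if "S \<in> Pow X" for S
  proof -
    have "y \<notin> S" and "\<And>x. x \<in> X \<Longrightarrow> x \<noteq> y"
      using that insert.hyps by auto
    then show "(\<Prod>x\<in>insert y X. \<phi> x (x \<in> insert y S)) = \<phi> y True * (\<Prod>x\<in>X. \<phi> x (x \<in> S))"
       "(\<Prod>x\<in>insert y X. \<phi> x (x \<in> S)) = \<phi> y False * (\<Prod>x\<in>X. \<phi> x (x \<in> S))"
      using insert.hyps by (simp_all cong: prod.cong)
  qed
  then have "(\<Sum>S\<in>Pow (insert y X). \<Prod>x\<in>insert y X. \<phi> x (x \<in> S))
      = \<phi> y True * (\<Sum>S\<in>Pow X. \<Prod>x\<in>X. \<phi> x (x \<in> S)) + \<phi> y False * (\<Sum>S\<in>Pow X. \<Prod>x\<in>X. \<phi> x (x \<in> S))"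
    unfolding sum_Pow_insert[OF insert.hyps(1,2)] sum_distrib_left
    by (intro arg_cong2[where f = "(+)"] sum.cong refl)
  then show ?case
    by (simp only: insert.IH prod.insert[OF insert.hyps(1,2)] distrib_right)
qed simp

lemma sum_coin_weight: "finite X \<Longrightarrow> (\<Sum>S\<in>Pow X. coin_weight \<delta> X S) = 1"
  using sum_Pow_prod[of X "\<lambda>_ t. (1 + \<delta> * (if t then 1 else - 1)) / 2"]
  unfolding coin_weight_def coin_sign_def by (simp add: add_divide_distrib [symmetric])

lemma coin_weight_insert:
  assumes "finite U" "x \<notin> U" "S \<subseteq> U"
  shows "coin_weight \<delta> (insert x U) (insert x S) = (1 + \<delta>) / 2 * coin_weight \<delta> U S"
    and "coin_weight \<delta> (insert x U) S = (1 - \<delta>) / 2 * coin_weight \<delta> U S"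
proof -
  have "coin_weight \<delta> U (insert x S) = coin_weight \<delta> U S"
    unfolding coin_weight_def using assms(2) by (intro prod.cong refl) (auto simp: coin_sign_def)
  then show "coin_weight \<delta> (insert x U) (insert x S) = (1 + \<delta>) / 2 * coin_weight \<delta> U S"
    using assms by (simp add: coin_weight_def coin_sign_def)
  show "coin_weight \<delta> (insert x U) S = (1 - \<delta>) / 2 * coin_weight \<delta> U S"
  proof -
    have "x \<notin> S" using assms by auto
    then have "coin_sign S x = - 1" by (simp add: coin_sign_def)
    then show ?thesis
      unfolding coin_weight_def using assms(1,2) by simp
  qed
qed

lemma coin_weight_compl: "S \<subseteq> X \<Longrightarrow> coin_weight (- \<delta>) X (X - S) = coin_weight \<delta> X S"
  unfolding coin_weight_def
proof (rule prod.cong [OF refl])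
  fix x assume "S \<subseteq> X" "x \<in> X"
  then have "coin_sign (X - S) x = - coin_sign S x"
    unfolding coin_sign_def by simp
  then show "(1 + - \<delta> * coin_sign (X - S) x) / 2 = (1 + \<delta> * coin_sign S x) / 2"
    by simp
qed

lemma sum_Pow_compl:
  fixes g :: "'a set \<Rightarrow> 'b::comm_monoid_add"
  shows "(\<Sum>S\<in>Pow X. g (X - S)) = (\<Sum>S\<in>Pow X. g S)"
  by (rule sum.reindex_bij_witness[of _ "\<lambda>S. X - S" "\<lambda>S. X - S"]) auto

section \<open>Tail bounds for weighted sums of biased signs\<close>

lemma biased_coin_exp_moment:
  fixes t \<delta> :: real
  assumes "\<bar>\<delta>\<bar> \<le> 1" "\<bar>t\<bar> \<le> 1"
  shows "(1 + \<delta>) / 2 * exp t + (1 - \<delta>) / 2 * exp (- t) \<le> exp (\<delta> * t + t\<^sup>2)"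
proof -
  \<comment> \<open>This crude bound stands in for Hoeffding's lemma: averaged over the two
    outcomes, its linear terms give \<open>\<delta> * t\<close>.\<close>
  have *: "exp s \<le> 1 + s + s\<^sup>2" if "\<bar>s\<bar> \<le> 1" for s :: real
  proof (cases "s \<ge> 0")
    case True
    then show ?thesis using exp_bound[of s] that by simp
  next
    case False
    \<comment> \<open>For negative \<open>s\<close> the Taylor bound
      \<open>1 - s + s\<^sup>2 / 2 \<le> exp (- s)\<close> is inverted.\<close>
    have "exp s * (1 - s + s\<^sup>2 / 2) \<le> 1"
      using exp_lower_Taylor_quadratic[of "- s"] False
      by (simp add: exp_minus field_simps)
    moreover have "(1 + s + s\<^sup>2) * (1 - s + s\<^sup>2 / 2) = 1 + (1/2) * s\<^sup>2 * (1 - s + s\<^sup>2)"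
      by (simp add: field_simps power2_eq_square)
    moreover have "(1/2) * s\<^sup>2 * (1 - s + s\<^sup>2) \<ge> 0"
      using False by (intro mult_nonneg_nonneg) auto
    ultimately have "exp s * (1 - s + s\<^sup>2 / 2) \<le> (1 + s + s\<^sup>2) * (1 - s + s\<^sup>2 / 2)"
      by linarith
    moreover have "1 - s + s\<^sup>2 / 2 > 0"
      using False by (simp add: add_pos_nonneg)
    ultimately show ?thesis
      by (rule mult_right_le_imp_le)
  qed
  have "(1 + \<delta>) / 2 * exp t + (1 - \<delta>) / 2 * exp (- t)
      \<le> (1 + \<delta>) / 2 * (1 + t + t\<^sup>2) + (1 - \<delta>) / 2 * (1 - t + t\<^sup>2)"
    using *[of t] *[of "- t"] assms by (intro add_mono mult_left_mono) auto
  also have "\<dots> = 1 + (\<delta> * t + t\<^sup>2)" by (simp add: field_simps)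
  also have "\<dots> \<le> exp (\<delta> * t + t\<^sup>2)" by (rule exp_ge_add_one_self)
  finally show ?thesis .
qed

text \<open>Chernoff's method with the fixed parameter \<open>1 / P\<close>: after rescaling, the
  squares sum to at most 1, so the centred exponential moment is at most \<open>exp 1\<close>. The
  tail is exponential and not Gaussian, which suffices because a threshold of order \<open>D\<close>
  times the norm is affordable.\<close>

lemma coin_tail:
  fixes a :: "'a \<Rightarrow> real"
  assumes fin: "finite X" and \<delta>: "\<bar>\<delta>\<bar> \<le> 1" and P: "P > 0" "(\<Sum>x\<in>X. (a x)\<^sup>2) \<le> P\<^sup>2"
  shows "(\<Sum>S | S \<subseteq> X \<and> \<tau> \<le> (\<Sum>x\<in>X. a x * (coin_sign S x - \<delta>)). coin_weight \<delta> X S)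
    \<le> exp (1 - \<tau> / P)"
proof -
  define t where "t x = a x / P" for x
  have t2: "(\<Sum>x\<in>X. (t x)\<^sup>2) \<le> 1"
    using P by (simp add: t_def power_divide sum_divide_distrib [symmetric])
  have t1: "\<bar>t x\<bar> \<le> 1" if "x \<in> X" for x
  proof -
    have "(t x)\<^sup>2 \<le> (\<Sum>x\<in>X. (t x)\<^sup>2)"
      using fin that by (intro member_le_sum) auto
    with t2 show ?thesis using abs_square_le_1[of "t x"] by linarith
  qed
  define Z where "Z S = (\<Sum>x\<in>X. t x * coin_sign S x)" for S
  have "(\<Sum>S\<in>Pow X. coin_weight \<delta> X S * exp (Z S))
      = (\<Sum>S\<in>Pow X. \<Prod>x\<in>X. (1 + \<delta> * (if x \<in> S then 1 else - 1)) / 2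
          * exp (t x * (if x \<in> S then 1 else - 1)))"
    unfolding coin_weight_def Z_def exp_sum[OF fin] coin_sign_def prod.distrib ..
  also have "\<dots> = (\<Prod>x\<in>X. (1 + \<delta>) / 2 * exp (t x) + (1 - \<delta>) / 2 * exp (- t x))"
    using sum_Pow_prod[OF fin, of "\<lambda>x b. (1 + \<delta> * (if b then 1 else - 1)) / 2
          * exp (t x * (if b then 1 else - 1))"] by simp
  also have "\<dots> \<le> (\<Prod>x\<in>X. exp (\<delta> * t x + (t x)\<^sup>2))"
    using \<delta> t1 by (intro prod_mono conjI biased_coin_exp_moment) (auto intro!: add_nonneg_nonneg)
  also have "\<dots> = exp (\<delta> * (\<Sum>x\<in>X. t x)) * exp (\<Sum>x\<in>X. (t x)\<^sup>2)"
    by (simp add: exp_sum[OF fin, symmetric] sum.distrib sum_distrib_left exp_add)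
  also have "\<dots> \<le> exp (\<delta> * (\<Sum>x\<in>X. t x)) * exp 1"
    using t2 by (intro mult_left_mono) auto
  finally have mgf: "(\<Sum>S\<in>Pow X. coin_weight \<delta> X S * exp (Z S)) \<le> exp (\<delta> * (\<Sum>x\<in>X. t x) + 1)"
    by (simp add: exp_add)
  have ZS: "\<tau> / P \<le> Z S - \<delta> * (\<Sum>x\<in>X. t x)"
    if "\<tau> \<le> (\<Sum>x\<in>X. a x * (coin_sign S x - \<delta>))" for S
  proof -
    have "\<tau> / P \<le> (\<Sum>x\<in>X. a x * (coin_sign S x - \<delta>)) / P"
      using that P(1) by (simp add: divide_right_mono)
    also have "\<dots> = Z S - \<delta> * (\<Sum>x\<in>X. t x)"
      unfolding Z_def t_def sum_divide_distrib sum_distrib_left sum_subtractf [symmetric]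
      using P(1) by (intro sum.cong) (auto simp: field_simps)
    finally show ?thesis .
  qed
  have "(\<Sum>S | S \<subseteq> X \<and> \<tau> \<le> (\<Sum>x\<in>X. a x * (coin_sign S x - \<delta>)). coin_weight \<delta> X S)
      \<le> (\<Sum>S | S \<subseteq> X \<and> \<tau> \<le> (\<Sum>x\<in>X. a x * (coin_sign S x - \<delta>)).
          coin_weight \<delta> X S * exp (Z S - \<delta> * (\<Sum>x\<in>X. t x) - \<tau> / P))"
  proof (intro sum_mono)
    fix S assume "S \<in> {S. S \<subseteq> X \<and> \<tau> \<le> (\<Sum>x\<in>X. a x * (coin_sign S x - \<delta>))}"
    then have "1 \<le> exp (Z S - \<delta> * (\<Sum>x\<in>X. t x) - \<tau> / P)"
      using ZS[of S] by simp
    then show "coin_weight \<delta> X S \<le> coin_weight \<delta> X S * exp (Z S - \<delta> * (\<Sum>x\<in>X. t x) - \<tau> / P)"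
      using mult_left_mono[OF _ coin_weight_nonneg[OF \<delta>, of X S]] by (metis mult.right_neutral)
  qed
  also have "\<dots> \<le> (\<Sum>S\<in>Pow X. coin_weight \<delta> X S * exp (Z S - \<delta> * (\<Sum>x\<in>X. t x) - \<tau> / P))"
    using fin coin_weight_nonneg[OF \<delta>] by (intro sum_mono2) (auto intro!: mult_nonneg_nonneg)
  also have "\<dots> = (\<Sum>S\<in>Pow X. coin_weight \<delta> X S * exp (Z S)) * exp (- \<delta> * (\<Sum>x\<in>X. t x) - \<tau> / P)"
  proof -
    have "exp (Z S - \<delta> * (\<Sum>x\<in>X. t x) - \<tau> / P) = exp (Z S) * exp (- \<delta> * (\<Sum>x\<in>X. t x) - \<tau> / P)" for S
      unfolding exp_add [symmetric] by (rule arg_cong[where f = exp]) simp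
    then show ?thesis
      by (simp only: sum_distrib_right mult.assoc)
  qed
  also have "\<dots> \<le> exp (\<delta> * (\<Sum>x\<in>X. t x) + 1) * exp (- \<delta> * (\<Sum>x\<in>X. t x) - \<tau> / P)"
    using mgf by (intro mult_right_mono) auto
  also have "\<dots> = exp (1 - \<tau> / P)"
    by (simp add: exp_add [symmetric])
  finally show ?thesis .
qed

lemma coin_tail_abs:
  fixes a :: "'a \<Rightarrow> real"
  assumes fin: "finite X" and \<delta>: "\<bar>\<delta>\<bar> \<le> 1" and P: "P > 0" "(\<Sum>x\<in>X. (a x)\<^sup>2) \<le> P\<^sup>2"
  shows "(\<Sum>S | S \<subseteq> X \<and> \<tau> \<le> \<bar>\<Sum>x\<in>X. a x * (coin_sign S x - \<delta>)\<bar>. coin_weight \<delta> X S)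
    \<le> 2 * exp (1 - \<tau> / P)"
proof -
  define T where "T a = {S. S \<subseteq> X \<and> \<tau> \<le> (\<Sum>x\<in>X. a x * (coin_sign S x - \<delta>))}" for a
  have finT: "finite (T a)" for a
    unfolding T_def by (rule finite_subset[of _ "Pow X"]) (use fin in auto)
  have "{S. S \<subseteq> X \<and> \<tau> \<le> \<bar>\<Sum>x\<in>X. a x * (coin_sign S x - \<delta>)\<bar>} \<subseteq> T a \<union> T (\<lambda>x. - a x)"
  proof
    fix S assume S: "S \<in> {S. S \<subseteq> X \<and> \<tau> \<le> \<bar>\<Sum>x\<in>X. a x * (coin_sign S x - \<delta>)\<bar>}"
    have "(\<Sum>x\<in>X. - a x * (coin_sign S x - \<delta>)) = - (\<Sum>x\<in>X. a x * (coin_sign S x - \<delta>))"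
      by (simp only: mult_minus_left sum_negf)
    with S show "S \<in> T a \<union> T (\<lambda>x. - a x)"
      unfolding T_def by (cases "(\<Sum>x\<in>X. a x * (coin_sign S x - \<delta>)) \<ge> 0") simp_all
  qed
  then have "(\<Sum>S | S \<subseteq> X \<and> \<tau> \<le> \<bar>\<Sum>x\<in>X. a x * (coin_sign S x - \<delta>)\<bar>. coin_weight \<delta> X S)
      \<le> (\<Sum>S\<in>T a \<union> T (\<lambda>x. - a x). coin_weight \<delta> X S)"
    using finT coin_weight_nonneg[OF \<delta>] by (intro sum_mono2) auto
  also have "\<dots> \<le> (\<Sum>S\<in>T a. coin_weight \<delta> X S) + (\<Sum>S\<in>T (\<lambda>x. - a x). coin_weight \<delta> X S)"
    using finT sum_nonneg[of "T a \<inter> T (\<lambda>x. - a x)" "coin_weight \<delta> X"]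
      coin_weight_nonneg[OF \<delta>, of X] by (simp add: sum_Un)
  also have "\<dots> \<le> exp (1 - \<tau> / P) + exp (1 - \<tau> / P)"
    unfolding T_def using P by (intro add_mono coin_tail[OF fin \<delta>]) auto
  finally show ?thesis by simp
qed

text \<open>The reversed triangle inequality of Lorentz geometry for the vectors
  \<open>(m1, sqrt c)\<close> and \<open>(m2, sqrt c)\<close>. It merges the two outcomes of a
  probe, whose masses differ but whose \<open>c\<close> is the same.\<close>

lemma sqrt_diff_square_superadditive:
  fixes m1 m2 c :: real
  assumes "0 \<le> c" "c \<le> m1\<^sup>2" "c \<le> m2\<^sup>2" "0 \<le> m1" "0 \<le> m2"
  shows "sqrt (m1\<^sup>2 - c) + sqrt (m2\<^sup>2 - c) \<le> sqrt ((m1 + m2)\<^sup>2 - 4 * c)"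
proof (rule real_le_rsqrt)
  have cm: "c \<le> m1 * m2"
  proof -
    have "c * c \<le> m1\<^sup>2 * m2\<^sup>2"
      using assms by (intro mult_mono) auto
    then have "c\<^sup>2 \<le> (m1 * m2)\<^sup>2"
      by (simp only: power2_eq_square[of c] power_mult_distrib)
    then show ?thesis
      using assms(4,5) by (rule_tac power2_le_imp_le) auto
  qed
  have "sqrt (m1\<^sup>2 - c) * sqrt (m2\<^sup>2 - c) \<le> m1 * m2 - c"
  proof -
    have "(m1\<^sup>2 - c) * (m2\<^sup>2 - c) \<le> (m1 * m2 - c)\<^sup>2"
    proof -
      have "(m1 * m2 - c)\<^sup>2 - (m1\<^sup>2 - c) * (m2\<^sup>2 - c) = c * (m1 - m2)\<^sup>2"
        by (simp add: power2_eq_square algebra_simps)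
      then show ?thesis using assms(1) by (smt (verit) mult_nonneg_nonneg zero_le_power2)
    qed
    then show ?thesis
      using cm by (simp add: real_sqrt_mult [symmetric] real_le_lsqrt)
  qed
  then show "(sqrt (m1\<^sup>2 - c) + sqrt (m2\<^sup>2 - c))\<^sup>2 \<le> (m1 + m2)\<^sup>2 - 4 * c"
    using assms by (simp add: power2_sum)
qed

text \<open>Le Cam's two-point bound for adaptive algorithms. \<open>U\<close> holds the unread
  coins, \<open>S0\<close> the coins read as positive, \<open>\<alpha>\<close> and
  \<open>\<beta>\<close> the likelihoods of the reads under the biases \<open>\<delta>\<close> and
  \<open>- \<delta>\<close>, and \<open>\<phi>\<close> is the probability of deciding for
  \<open>\<delta>\<close>. The factor \<open>1 - \<delta>\<^sup>2\<close> is the squared Hellinger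
  affinity of the two laws of one coin. The likelihoods stay unnormalised so that the claim can be
  applied to both subtrees of a probe.\<close>

lemma probe_error_lower_bound:
  fixes A :: probe_alg and b :: "'a set \<Rightarrow> real vec" and \<pi> :: "nat \<Rightarrow> 'a"
    and \<phi> :: "real \<Rightarrow> real"
  assumes \<delta>: "0 \<le> \<delta>" "\<delta> \<le> 1" and \<phi>: "\<And>r. 0 \<le> \<phi> r" "\<And>r. \<phi> r \<le> 1"
    and dep: "\<And>i S S'. (\<pi> i \<in> S \<longleftrightarrow> \<pi> i \<in> S') \<Longrightarrow> b S $ i = b S' $ i"
  shows "finite U \<Longrightarrow> U \<inter> S0 = {} \<Longrightarrow> 0 \<le> \<alpha> \<Longrightarrow> 0 \<le> \<beta> \<Longrightarrow>
    (\<And>S. S \<subseteq> U \<Longrightarrow> card (\<pi> ` probed A (b (S0 \<union> S)) \<inter> U) \<le> q) \<Longrightarrow>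
    (\<alpha> + \<beta>) - sqrt ((\<alpha> + \<beta>)\<^sup>2 - 4 * \<alpha> * \<beta> * (1 - \<delta>\<^sup>2) ^ q)
      \<le> 2 * (\<Sum>S\<in>Pow U. \<alpha> * coin_weight \<delta> U S * (1 - \<phi> (answer A (b (S0 \<union> S))))
            + \<beta> * coin_weight (- \<delta>) U S * \<phi> (answer A (b (S0 \<union> S))))"
proof (induction A arbitrary: U S0 q \<alpha> \<beta>)
  case (Answer r)
  \<comment> \<open>A verdict without further reads errs with mass at least
    \<open>min \<alpha> \<beta>\<close>, which is the case \<open>q = 0\<close>; a larger
    \<open>q\<close> only weakens the claim.\<close>
  have "(1 - \<delta>\<^sup>2) ^ q \<le> 1"
    using \<delta> by (intro power_le_one) (auto simp: power_le_one)
  then have "4 * \<alpha> * \<beta> * (1 - \<delta>\<^sup>2) ^ q \<le> 4 * \<alpha> * \<beta>"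
    using Answer by (simp add: mult_left_le)
  then have "(\<alpha> - \<beta>)\<^sup>2 \<le> (\<alpha> + \<beta>)\<^sup>2 - 4 * \<alpha> * \<beta> * (1 - \<delta>\<^sup>2) ^ q"
    by (simp add: power2_eq_square algebra_simps)
  then have "\<bar>\<alpha> - \<beta>\<bar> \<le> sqrt ((\<alpha> + \<beta>)\<^sup>2 - 4 * \<alpha> * \<beta> * (1 - \<delta>\<^sup>2) ^ q)"
    using real_le_rsqrt[of "\<bar>\<alpha> - \<beta>\<bar>"] by simp
  moreover have "\<alpha> + \<beta> - \<bar>\<alpha> - \<beta>\<bar> \<le> 2 * (\<alpha> * (1 - \<phi> r) + \<beta> * \<phi> r)"
  proof -
    have "min \<alpha> \<beta> = min \<alpha> \<beta> * (1 - \<phi> r) + min \<alpha> \<beta> * \<phi> r"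
      by (simp add: algebra_simps)
    also have "\<dots> \<le> \<alpha> * (1 - \<phi> r) + \<beta> * \<phi> r"
      using \<phi>[of r] by (intro add_mono mult_right_mono) auto
    finally show ?thesis by (simp add: min_def split: if_splits)
  qed
  moreover have "(\<Sum>S\<in>Pow U. \<alpha> * coin_weight \<delta> U S * (1 - \<phi> r) + \<beta> * coin_weight (- \<delta>) U S * \<phi> r)
      = \<alpha> * (1 - \<phi> r) + \<beta> * \<phi> r"
    using Answer.prems(1)
    by (simp add: sum.distrib sum_distrib_left [symmetric] sum_distrib_right [symmetric]
        sum_coin_weight)
  ultimately show ?case by simp
next
  case (Probe i f)
  note fin = Probe.prems(1) and disj = Probe.prems(2) and pos = Probe.prems(3,4)
    and bound = Probe.prems(5)
  show ?case
  proof (cases "\<pi> i \<in> U")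
    case False
    \<comment> \<open>A coordinate whose coin is outside \<open>U\<close> is already fixed by
      \<open>S0\<close>, so the same subtree is entered for all \<open>S\<close>.\<close>
    have eq: "b (S0 \<union> S) $ i = b S0 $ i" if "S \<subseteq> U" for S
      using False that by (rule_tac dep) auto
    have "card (\<pi> ` probed (f (b S0 $ i)) (b (S0 \<union> S)) \<inter> U) \<le> q" if "S \<subseteq> U" for S
      using bound[OF that] eq[OF that] False by simp
    from Probe.IH[OF _ fin disj pos this]
    have "(\<alpha> + \<beta>) - sqrt ((\<alpha> + \<beta>)\<^sup>2 - 4 * \<alpha> * \<beta> * (1 - \<delta>\<^sup>2) ^ q)
      \<le> 2 * (\<Sum>S\<in>Pow U. \<alpha> * coin_weight \<delta> U S * (1 - \<phi> (answer (f (b S0 $ i)) (b (S0 \<union> S))))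
            + \<beta> * coin_weight (- \<delta>) U S * \<phi> (answer (f (b S0 $ i)) (b (S0 \<union> S))))"
      by simp
    also have "\<dots> = 2 * (\<Sum>S\<in>Pow U. \<alpha> * coin_weight \<delta> U S * (1 - \<phi> (answer (Probe i f) (b (S0 \<union> S))))
            + \<beta> * coin_weight (- \<delta>) U S * \<phi> (answer (Probe i f) (b (S0 \<union> S))))"
      by (intro arg_cong[where f = "\<lambda>t. 2 * t"] sum.cong) (simp_all add: eq)
    finally show ?thesis .
  next
    case True
    define x where "x = \<pi> i"
    define V where "V = U - {x}"
    have U: "U = insert x V" and x: "x \<notin> V" "x \<notin> S0" "finite V"
      using True fin disj by (auto simp: x_def V_def)
    have eq: "b (S0 \<union> S) $ i = b S0 $ i" "b (S0 \<union> insert x S) $ i = b (insert x S0) $ i"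
      if "S \<subseteq> V" for S
      using x(1,2) that by (rule_tac dep, fastforce simp: x_def)+
    \<comment> \<open>This probe reads a new coin, so the budget \<open>q\<close> is positive; any
      input, here the empty set, shows it.\<close>
    have "card (\<pi> ` probed (Probe i f) (b (S0 \<union> {})) \<inter> U) \<noteq> 0"
      using True fin by (auto simp: card_eq_0_iff)
    then obtain q' where q': "q = Suc q'"
      using bound[of "{}"] by (cases q) auto
    have drop: "card (\<pi> ` Q \<inter> V) \<le> q'" if "card (\<pi> ` insert i Q \<inter> U) \<le> q" for Q
    proof -
      have "\<pi> ` insert i Q \<inter> U = insert x (\<pi> ` Q \<inter> V)"
        by (auto simp: U x_def)
      then have "card (\<pi> ` insert i Q \<inter> U) = Suc (card (\<pi> ` Q \<inter> V))"
        using x by (simp add: finite_subset[OF Int_lower2])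
      with that q' show ?thesis by simp
    qed
    define \<kappa> where "\<kappa> = (1 - \<delta>\<^sup>2) ^ q'"
    define err where "err S = \<alpha> * coin_weight \<delta> U S * (1 - \<phi> (answer (Probe i f) (b (S0 \<union> S))))
            + \<beta> * coin_weight (- \<delta>) U S * \<phi> (answer (Probe i f) (b (S0 \<union> S)))" for S
    define p where "p = (1 + \<delta>) / 2"
    define r where "r = (1 - \<delta>) / 2"
    have pr: "0 \<le> p" "0 \<le> r" "p + r = 1" "p * r = (1 - \<delta>\<^sup>2) / 4"
      using \<delta> by (auto simp: p_def r_def power2_eq_square field_simps)
    have d2: "\<delta>\<^sup>2 \<le> 1" using \<delta> by (simp add: power_le_one)
    have \<kappa>: "0 \<le> \<kappa>" "\<kappa> \<le> 1"
      using d2 by (auto simp: \<kappa>_def intro: power_le_one)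
    have in1: "card (\<pi> ` probed (f (b (insert x S0) $ i)) (b (insert x S0 \<union> S)) \<inter> V) \<le> q'"
      if "S \<subseteq> V" for S
    proof (rule drop)
      have "insert x S \<subseteq> U" using that U by auto
      from bound[OF this] eq(2)[OF that]
      show "card (\<pi> ` insert i (probed (f (b (insert x S0) $ i)) (b (insert x S0 \<union> S))) \<inter> U) \<le> q"
        by simp
    qed
    have in0: "card (\<pi> ` probed (f (b S0 $ i)) (b (S0 \<union> S)) \<inter> V) \<le> q'" if "S \<subseteq> V" for S
    proof (rule drop)
      have "S \<subseteq> U" using that U by auto
      from bound[OF this] eq(1)[OF that]
      show "card (\<pi> ` insert i (probed (f (b S0 $ i)) (b (S0 \<union> S))) \<inter> U) \<le> q"
        by simp
    qed
    have "(\<alpha> * p + \<beta> * r) - sqrt ((\<alpha> * p + \<beta> * r)\<^sup>2 - 4 * (\<alpha> * p) * (\<beta> * r) * \<kappa>)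
      \<le> 2 * (\<Sum>S\<in>Pow V. (\<alpha> * p) * coin_weight \<delta> V S
              * (1 - \<phi> (answer (f (b (insert x S0) $ i)) (b (insert x S0 \<union> S))))
            + (\<beta> * r) * coin_weight (- \<delta>) V S * \<phi> (answer (f (b (insert x S0) $ i)) (b (insert x S0 \<union> S))))"
      unfolding \<kappa>_def using x pos pr in1 disj U
      by (intro Probe.IH) auto
    also have "\<dots> = 2 * (\<Sum>S\<in>Pow V. err (insert x S))"
      using x eq by (intro arg_cong[where f = "\<lambda>t. 2 * t"] sum.cong)
        (auto simp: err_def U coin_weight_insert p_def r_def)
    finally have e1: "(\<alpha> * p + \<beta> * r) - sqrt ((\<alpha> * p + \<beta> * r)\<^sup>2 - 4 * (\<alpha> * p) * (\<beta> * r) * \<kappa>)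
        \<le> 2 * (\<Sum>S\<in>Pow V. err (insert x S))" .
    have "(\<alpha> * r + \<beta> * p) - sqrt ((\<alpha> * r + \<beta> * p)\<^sup>2 - 4 * (\<alpha> * r) * (\<beta> * p) * \<kappa>)
      \<le> 2 * (\<Sum>S\<in>Pow V. (\<alpha> * r) * coin_weight \<delta> V S * (1 - \<phi> (answer (f (b S0 $ i)) (b (S0 \<union> S))))
            + (\<beta> * p) * coin_weight (- \<delta>) V S * \<phi> (answer (f (b S0 $ i)) (b (S0 \<union> S))))"
      unfolding \<kappa>_def using x pos pr in0 disj U
      by (intro Probe.IH) auto
    also have "\<dots> = 2 * (\<Sum>S\<in>Pow V. err S)"
      using x eq by (intro arg_cong[where f = "\<lambda>t. 2 * t"] sum.cong)
        (auto simp: err_def U coin_weight_insert p_def r_def)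
    finally have e2: "(\<alpha> * r + \<beta> * p) - sqrt ((\<alpha> * r + \<beta> * p)\<^sup>2 - 4 * (\<alpha> * r) * (\<beta> * p) * \<kappa>)
        \<le> 2 * (\<Sum>S\<in>Pow V. err S)" .
    \<comment> \<open>The products \<open>(\<alpha> * p) * (\<beta> * r)\<close> and
      \<open>(\<alpha> * r) * (\<beta> * p)\<close> agree, so both subtrees come with the same
      \<open>c\<close>.\<close>
    define c where "c = 4 * \<alpha> * \<beta> * (p * r) * \<kappa>"
    have c_le: "c \<le> (\<alpha> * s + \<beta> * t)\<^sup>2" if "s * t = p * r" "0 \<le> s" "0 \<le> t" for s t
    proof -
      have "0 \<le> (\<alpha> * s - \<beta> * t)\<^sup>2" by simp
      then have "4 * (\<alpha> * \<beta> * (s * t)) \<le> (\<alpha> * s + \<beta> * t)\<^sup>2"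
        by (simp add: power2_eq_square algebra_simps)
      moreover have "(\<alpha> * \<beta> * (s * t)) * \<kappa> \<le> \<alpha> * \<beta> * (s * t)"
        using \<kappa> pos that(2,3) by (intro mult_left_le mult_nonneg_nonneg)
      moreover have "c = 4 * ((\<alpha> * \<beta> * (s * t)) * \<kappa>)"
        unfolding c_def that(1) by simp
      ultimately show ?thesis by linarith
    qed
    have "sqrt ((\<alpha> * p + \<beta> * r)\<^sup>2 - c) + sqrt ((\<alpha> * r + \<beta> * p)\<^sup>2 - c)
        \<le> sqrt ((\<alpha> * p + \<beta> * r + (\<alpha> * r + \<beta> * p))\<^sup>2 - 4 * c)"
    proof (rule sqrt_diff_square_superadditive)
      show "0 \<le> c" "0 \<le> \<alpha> * p + \<beta> * r" "0 \<le> \<alpha> * r + \<beta> * p"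
        using pos pr(1,2) \<kappa>(1) by (simp_all add: c_def)
      show "c \<le> (\<alpha> * p + \<beta> * r)\<^sup>2" "c \<le> (\<alpha> * r + \<beta> * p)\<^sup>2"
        using pr(1,2) by (simp_all add: c_le mult.commute)
    qed
    moreover have ab: "\<alpha> * p + \<beta> * r + (\<alpha> * r + \<beta> * p) = \<alpha> + \<beta>"
    proof -
      have "\<alpha> * p + \<beta> * r + (\<alpha> * r + \<beta> * p) = \<alpha> * (p + r) + \<beta> * (p + r)"
        by (simp add: distrib_left)
      then show ?thesis by (simp add: pr(3))
    qed
    moreover have c4: "4 * c = 4 * \<alpha> * \<beta> * (1 - \<delta>\<^sup>2) ^ q"
      using pr(4) by (simp add: c_def \<kappa>_def q')
    moreover have c': "4 * (\<alpha> * p) * (\<beta> * r) * \<kappa> = c" "4 * (\<alpha> * r) * (\<beta> * p) * \<kappa> = c"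
      by (simp_all add: c_def mult_ac)
    ultimately have "sqrt ((\<alpha> * p + \<beta> * r)\<^sup>2 - c) + sqrt ((\<alpha> * r + \<beta> * p)\<^sup>2 - c)
        \<le> sqrt ((\<alpha> + \<beta>)\<^sup>2 - 4 * \<alpha> * \<beta> * (1 - \<delta>\<^sup>2) ^ q)"
      by (simp only: ab c4)
    moreover have "(\<Sum>S\<in>Pow U. err S) = (\<Sum>S\<in>Pow V. err (insert x S)) + (\<Sum>S\<in>Pow V. err S)"
      unfolding U using x by (intro sum_Pow_insert) auto
    ultimately have "(\<alpha> + \<beta>) - sqrt ((\<alpha> + \<beta>)\<^sup>2 - 4 * \<alpha> * \<beta> * (1 - \<delta>\<^sup>2) ^ q)
        \<le> 2 * (\<Sum>S\<in>Pow U. err S)"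
      using e1[unfolded c'] e2[unfolded c'] ab by linarith
    then show ?thesis unfolding err_def .
  qed
qed

lemma sqrt_bernoulli_gap:
  assumes "0 \<le> \<delta>" "\<delta> \<le> (1::real)"
  shows "sqrt (1 - (1 - \<delta>\<^sup>2) ^ q) \<le> sqrt (real q * \<delta>\<^sup>2)"
proof -
  have "1 + real q * (- \<delta>\<^sup>2) \<le> (1 + (- \<delta>\<^sup>2)) ^ q"
    using assms by (intro Bernoulli_inequality) (simp add: power_le_one)
  then show ?thesis by simp
qed

text \<open>
  The two hypotheses are the coin biases \<open>\<delta>\<close> and \<open>-\<delta>\<close>; complementing the set of coins exchanges
  them, so a sign error on either side is charged to the same set \<open>S\<close>.
\<close>

lemma biased_coin_probe_lower_bound:
  fixes R :: "probe_alg measure" and b :: "'a set \<Rightarrow> real vec" and \<pi> :: "nat \<Rightarrow> 'a"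
  assumes "prob_space R" and fin: "finite X" and \<delta>: "0 \<le> \<delta>" "\<delta> \<le> 1"
    and dep: "\<And>i S S'. (\<pi> i \<in> S \<longleftrightarrow> \<pi> i \<in> S') \<Longrightarrow> b S $ i = b S' $ i"
    and cost: "\<And>S. S \<subseteq> X \<Longrightarrow> AE A in R. card (probed A (b S)) \<le> q"
    and good: "good \<subseteq> Pow X" "(\<Sum>S\<in>good. coin_weight \<delta> X S) \<ge> 7 / 8"
    and prob: "\<And>S. S \<in> good \<Longrightarrow> measure R {A \<in> space R. ok S A} \<ge> 2 / 3"
      "\<And>S. S \<in> good \<Longrightarrow> measure R {A \<in> space R. ok' S A} \<ge> 2 / 3"
    and ok: "\<And>S A. S \<in> good \<Longrightarrow> ok S A \<Longrightarrow> answer A (b S) > 0"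
      "\<And>S A. S \<in> good \<Longrightarrow> ok' S A \<Longrightarrow> answer A (b (X - S)) < 0"
  shows "1 / 36 \<le> real q * \<delta>\<^sup>2"
proof -
  interpret prob_space R by fact
  define w where "w = coin_weight \<delta> X"
  have w0: "w S \<ge> 0" for S
    unfolding w_def using \<delta> by (intro coin_weight_nonneg) auto
  have fing: "finite good"
    using good(1) fin by (meson finite_Pow_iff finite_subset)
  define F where "F S = {A \<in> space R. ok S A}" for S
  define H where "H S = {A \<in> space R. ok' S A}" for S
  \<comment> \<open>A set of positive \<open>measure\<close> is measurable, because
    \<open>measure\<close> is 0 off the sigma-algebra.\<close>
  have FH: "F S \<in> sets R" "H S \<in> sets R" if "S \<in> good" for S
    using prob[OF that] measure_notin_sets[of "F S" R] measure_notin_sets[of "H S" R]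
    by (auto simp: F_def H_def)
  \<comment> \<open>Yao's principle: \<open>g\<close> is the weighted number of successes of one
    tree on \<open>S\<close> and on the complement of \<open>S\<close>. Its mean is at least
    \<open>7/8 * 4/3 = 7/6\<close>, while a tree with \<open>q\<close> probes reaches at most
    \<open>1 + sqrt (q * \<delta>\<^sup>2)\<close>; the excess \<open>1/6\<close> is squared at the
    end.\<close>
  define g :: "probe_alg \<Rightarrow> real" where
    "g A = (\<Sum>S\<in>good. w S * (indicator (F S) A + indicator (H S) A))" for A
  have int: "integrable R (\<lambda>A. w S * (indicator (F S) A + indicator (H S) A))" if "S \<in> good" for S
    using FH[OF that] by (intro integrable_mult_right Bochner_Integration.integrable_add)
      (auto simp: emeasure_eq_measure)
  have "7 / 6 \<le> (\<Sum>S\<in>good. w S * (4 / 3))"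
    using good(2) unfolding sum_distrib_right [symmetric] w_def by simp
  also have "\<dots> \<le> (\<Sum>S\<in>good. w S * (prob (F S) + prob (H S)))"
    using prob w0 by (intro sum_mono mult_left_mono) (fastforce simp: F_def H_def)+
  also have "\<dots> = (\<integral>A. g A \<partial>R)"
    unfolding g_def
    by (subst Bochner_Integration.integral_sum)
      (use int FH in \<open>auto intro!: sum.cong simp: emeasure_eq_measure\<close>)
  finally have lower: "7 / 6 \<le> (\<integral>A. g A \<partial>R)" .
  define B where "B = 1 + sqrt (real q * \<delta>\<^sup>2)"
  have pointwise: "g A \<le> B"
    if A: "A \<in> space R" and c: "\<And>S. S \<in> Pow X \<Longrightarrow> card (probed A (b S)) \<le> q" for A
  proof -
    define \<phi> :: "real \<Rightarrow> real" where "\<phi> r = (if r > 0 then 1 else 0)" for r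
    have \<phi>: "0 \<le> \<phi> r" "\<phi> r \<le> 1" for r by (auto simp: \<phi>_def)
    have finp: "finite (probed A' v)" for A' v
      by (induction A') auto
    have "card (\<pi> ` probed A (b ({} \<union> S)) \<inter> X) \<le> q" if "S \<subseteq> X" for S
    proof -
      have "card (\<pi> ` probed A (b S) \<inter> X) \<le> card (\<pi> ` probed A (b S))"
        by (intro card_mono finite_imageI finp) auto
      also have "\<dots> \<le> card (probed A (b S))" by (intro card_image_le finp)
      also have "\<dots> \<le> q" using c that by auto
      finally show ?thesis by simp
    qed
    from probe_error_lower_bound[where b = b and \<pi> = \<pi> and \<phi> = \<phi> and U = X and ?S0.0 = "{}"
        and \<alpha> = 1 and \<beta> = 1, OF \<delta> \<phi> dep fin _ _ _ this]
    have "2 - sqrt (4 - 4 * (1 - \<delta>\<^sup>2) ^ q)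
      \<le> 2 * ((\<Sum>S\<in>Pow X. w S * (1 - \<phi> (answer A (b S))))
        + (\<Sum>S\<in>Pow X. coin_weight (- \<delta>) X S * \<phi> (answer A (b S))))"
      by (simp add: w_def sum.distrib)
    moreover have "sqrt (4 - 4 * (1 - \<delta>\<^sup>2) ^ q) = 2 * sqrt (1 - (1 - \<delta>\<^sup>2) ^ q)"
    proof -
      have "sqrt (4 - 4 * (1 - \<delta>\<^sup>2) ^ q) = sqrt (4 * (1 - (1 - \<delta>\<^sup>2) ^ q))"
        by (simp add: algebra_simps)
      then show ?thesis by (simp only: real_sqrt_mult real_sqrt_four)
    qed
    ultimately have "2 * (1 - sqrt (1 - (1 - \<delta>\<^sup>2) ^ q)) \<le> 2 * ((\<Sum>S\<in>Pow X. w S * (1 - \<phi> (answer A (b S))))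
        + (\<Sum>S\<in>Pow X. coin_weight (- \<delta>) X S * \<phi> (answer A (b S))))"
      by simp
    then have "1 - sqrt (1 - (1 - \<delta>\<^sup>2) ^ q) \<le> (\<Sum>S\<in>Pow X. w S * (1 - \<phi> (answer A (b S))))
        + (\<Sum>S\<in>Pow X. coin_weight (- \<delta>) X S * \<phi> (answer A (b S)))"
      by (rule mult_left_le_imp_le) simp
    also have "(\<Sum>S\<in>Pow X. coin_weight (- \<delta>) X S * \<phi> (answer A (b S)))
        = (\<Sum>S\<in>Pow X. coin_weight (- \<delta>) X (X - S) * \<phi> (answer A (b (X - S))))"
      by (rule sum_Pow_compl [symmetric])
    also have "\<dots> = (\<Sum>S\<in>Pow X. w S * \<phi> (answer A (b (X - S))))"
      by (intro sum.cong) (auto simp: w_def coin_weight_compl)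
    finally have err: "1 - sqrt (1 - (1 - \<delta>\<^sup>2) ^ q)
        \<le> (\<Sum>S\<in>Pow X. w S * (1 - \<phi> (answer A (b S)))) + (\<Sum>S\<in>Pow X. w S * \<phi> (answer A (b (X - S))))" .
    have "g A \<le> (\<Sum>S\<in>good. w S * (\<phi> (answer A (b S)) + (1 - \<phi> (answer A (b (X - S))))))"
      unfolding g_def
    proof (intro sum_mono mult_left_mono add_mono w0)
      fix S assume S: "S \<in> good"
      show "indicator (F S) A \<le> \<phi> (answer A (b S))"
        using ok(1)[OF S, of A] by (auto simp: F_def \<phi>_def indicator_def)
      show "indicator (H S) A \<le> 1 - \<phi> (answer A (b (X - S)))"
        using ok(2)[OF S, of A] by (auto simp: H_def \<phi>_def indicator_def)
    qed
    also have "\<dots> \<le> (\<Sum>S\<in>Pow X. w S * (\<phi> (answer A (b S)) + (1 - \<phi> (answer A (b (X - S))))))"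
      using fin good(1) w0 \<phi> by (intro sum_mono2) (auto intro!: mult_nonneg_nonneg add_nonneg_nonneg)
    also have "\<dots> = 2 * (\<Sum>S\<in>Pow X. w S) - ((\<Sum>S\<in>Pow X. w S * (1 - \<phi> (answer A (b S))))
        + (\<Sum>S\<in>Pow X. w S * \<phi> (answer A (b (X - S)))))"
      by (simp add: sum.distrib [symmetric] sum_subtractf [symmetric] sum_distrib_left algebra_simps)
    also have "\<dots> \<le> 1 + sqrt (1 - (1 - \<delta>\<^sup>2) ^ q)"
      using err sum_coin_weight[OF fin, of \<delta>] by (simp add: w_def)
    also have "\<dots> \<le> B"
      using sqrt_bernoulli_gap[OF \<delta>] by (simp add: B_def)
    finally show ?thesis .
  qed
  have "AE A in R. \<forall>S\<in>Pow X. card (probed A (b S)) \<le> q"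
    using fin cost by (intro AE_finite_allI) auto
  then have "AE A in R. g A \<le> B"
    using AE_space by eventually_elim (use pointwise in auto)
  moreover have "integrable R g"
    unfolding g_def using int by (intro Bochner_Integration.integrable_sum)
  ultimately have "(\<integral>A. g A \<partial>R) \<le> (\<integral>A. B \<partial>R)"
    by (intro integral_mono_AE) auto
  with lower have "1 / 6 \<le> sqrt (real q * \<delta>\<^sup>2)"
    by (simp add: B_def prob_space)
  then have "(1 / 6)\<^sup>2 \<le> (sqrt (real q * \<delta>\<^sup>2))\<^sup>2"
    by (intro power_mono) auto
  then show ?thesis by (simp add: power_divide)
qed

section \<open>Graph Laplacians\<close>

definition graph_lap :: "('a \<times> 'a) set \<Rightarrow> ('a \<Rightarrow> real) \<Rightarrow> 'a \<Rightarrow> real" where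
  "graph_lap E f a = (\<Sum>b\<in>E `` {a}. f a - f b)"

text \<open>The factor 1/2 makes each undirected edge, present in a symmetric \<open>E\<close> as
  two arcs, count once.\<close>

definition dirichlet_form :: "('a \<times> 'a) set \<Rightarrow> ('a \<Rightarrow> real) \<Rightarrow> ('a \<Rightarrow> real) \<Rightarrow> real" where
  "dirichlet_form E f g = (\<Sum>(a, b)\<in>E. (f a - f b) * (g a - g b)) / 2"

lemma dirichlet_form_commute: "dirichlet_form E f g = dirichlet_form E g f"
  unfolding dirichlet_form_def by (simp add: mult.commute)

lemma dirichlet_form_nonneg: "dirichlet_form E f f \<ge> 0"
  unfolding dirichlet_form_def by (auto intro!: sum_nonneg)

text \<open>Summation by parts: pairing every arc with its reverse symmetrises the sum over
  \<open>E\<close>.\<close>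

lemma sum_graph_lap:
  assumes fin: "finite V" and E: "E \<subseteq> V \<times> V" "sym E"
  shows "(\<Sum>a\<in>V. f a * graph_lap E g a) = dirichlet_form E f g"
proof -
  have EV: "Sigma V (\<lambda>a. E `` {a}) = E" using E(1) by auto
  have "finite (E `` {a})" for a
    using fin E(1) by (auto intro: finite_subset[of _ V])
  then have "(\<Sum>a\<in>V. f a * graph_lap E g a) = (\<Sum>(a, b)\<in>E. f a * (g a - g b))"
    unfolding graph_lap_def sum_distrib_left using fin by (subst sum.Sigma) (auto simp: EV)
  moreover have "(\<Sum>(a, b)\<in>E. f a * (g a - g b)) = (\<Sum>(a, b)\<in>E. f b * (g b - g a))"
    using E(2) by (intro sum.reindex_bij_witness[of _ prod.swap prod.swap]) (auto dest: symD)
  ultimately have "2 * (\<Sum>a\<in>V. f a * graph_lap E g a)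
      = (\<Sum>(a, b)\<in>E. f a * (g a - g b)) + (\<Sum>(a, b)\<in>E. f b * (g b - g a))"
    by simp
  also have "\<dots> = (\<Sum>(a, b)\<in>E. (f a - f b) * (g a - g b))"
    by (simp add: sum.distrib [symmetric] case_prod_beta algebra_simps)
  finally show ?thesis by (simp add: dirichlet_form_def)
qed

text \<open>The matrix form, shared by the Laplacian matrix and by the linear system that defines
  the Green functions.\<close>

lemma graph_lap_eq_kernel:
  assumes "finite V" "E `` {a} \<subseteq> V" "a \<in> V"
  shows "graph_lap E f a
    = (\<Sum>b\<in>V. ((if b = a then real (card (E `` {a})) else 0) - (if (a, b) \<in> E then 1 else 0)) * f b)"
proof -
  have "(\<Sum>b\<in>V. ((if b = a then real (card (E `` {a})) else 0) - (if (a, b) \<in> E then 1 else 0)) * f b)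
      = (\<Sum>b\<in>V. (if b = a then real (card (E `` {a})) * f b else 0) - (if b \<in> E `` {a} then f b else 0))"
    by (intro sum.cong) (auto simp: left_diff_distrib)
  also have "\<dots> = real (card (E `` {a})) * f a - (\<Sum>b\<in>V \<inter> E `` {a}. f b)"
    using assms by (simp only: sum_subtractf sum.inter_restrict) simp
  also have "V \<inter> E `` {a} = E `` {a}" using assms(2) by blast
  finally show ?thesis by (simp add: graph_lap_def sum_subtractf)
qed

lemma out_degree_with_proj:
  "out_degree (with_proj G) a = card (parcs G `` {a})"
proof -
  have "out_arcs (with_proj G) a = Pair a ` (parcs G `` {a})"
    by (auto simp: out_arcs_def)
  then show ?thesis by (simp add: out_degree_def card_image inj_on_def)
qed

lemma laplacian_carrier:
  assumes "pverts G = {0..<n}"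
  shows "laplacian G \<in> carrier_mat n n"
  using assms unfolding laplacian_def degree_matrix_def adjacency_matrix_def Let_def
  by (intro minus_carrier_mat) simp

lemma laplacian_mult_vec:
  assumes V: "pverts G = {0..<n}" and E: "parcs G \<subseteq> {0..<n} \<times> {0..<n}" and i: "i < n"
  shows "(laplacian G *\<^sub>v vec n f) $ i = graph_lap (parcs G) f i"
proof -
  have N: "parcs G `` {i} \<subseteq> {0..<n}" using E by auto
  have entry: "laplacian G $$ (i, j) = (if j = i then real (card (parcs G `` {i})) else 0)
      - (if (i, j) \<in> parcs G then 1 else 0)" if "j < n" for j
    using that i V by (simp add: laplacian_def degree_matrix_def adjacency_matrix_def Let_def
        mat_diag_def out_degree_with_proj)
  have "(laplacian G *\<^sub>v vec n f) $ i = (\<Sum>j\<in>{0..<n}. laplacian G $$ (i, j) * f j)"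
    using laplacian_carrier[OF V] i by (simp add: scalar_prod_def)
  also have "\<dots> = graph_lap (parcs G) f i"
    by (subst graph_lap_eq_kernel[OF _ N]) (use i in \<open>auto simp: entry intro!: sum.cong\<close>)
  finally show ?thesis .
qed

section \<open>The star and the spectrum it contributes\<close>

definition star_arcs :: "(nat \<times> nat) set" where
  "star_arcs = {0} \<times> {1..4} \<union> {1..4} \<times> {0}"

definition star_plus :: "nat \<Rightarrow> (nat \<times> nat) set \<Rightarrow> nat pair_pre_digraph" where
  "star_plus n F = \<lparr> pverts = {0..<n}, parcs = star_arcs \<union> F \<rparr>"

text \<open>\<open>F\<close> is kept abstract for two uses: the doubled heap, and the empty set when
  \<open>k\<close> is bounded.\<close>

locale far_arcs =
  fixes n :: nat and F :: "(nat \<times> nat) set"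
  assumes n5: "5 \<le> n" and F: "F \<subseteq> {5..<n} \<times> {5..<n}" "sym F" "irrefl F"
    and deg4: "\<And>a. card (F `` {a}) \<le> 4"
begin

lemma pverts_star [simp]: "pverts (star_plus n F) = {0..<n}"
  and parcs_star [simp]: "parcs (star_plus n F) = star_arcs \<union> F"
  by (simp_all add: star_plus_def)

lemma parcs_subset: "star_arcs \<union> F \<subseteq> {0..<n} \<times> {0..<n}"
  using n5 F(1) by (auto simp: star_arcs_def)

lemma pair_graph_star: "pair_graph (star_plus n F)"
proof
  have "finite (star_arcs \<union> F)" using parcs_subset by (rule finite_subset) auto
  then show "finite (parcs (star_plus n F))" by simp
  have "sym (star_arcs \<union> F)" using F(2) by (auto simp: star_arcs_def sym_def)
  then show "symmetric (with_proj (star_plus n F))"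
    by (simp add: symmetric_def)
  show "fst e \<noteq> snd e" if "e \<in> parcs (star_plus n F)" for e
    using that F(3) by (cases e) (auto simp: star_arcs_def irrefl_def)
qed (use parcs_subset in auto)

lemma nbrs:
  "(star_arcs \<union> F) `` {0} = {1..4}"
  "i \<in> {1..4} \<Longrightarrow> (star_arcs \<union> F) `` {i} = {0}"
  "5 \<le> a \<Longrightarrow> (star_arcs \<union> F) `` {a} = F `` {a}"
  using F(1) by (auto simp: star_arcs_def)

lemma card_nbrs: "card ((star_arcs \<union> F) `` {a}) \<le> 4"
proof -
  consider "a = 0" | "a \<in> {1..4}" | "5 \<le> a" by force
  then show ?thesis by cases (auto simp: nbrs deg4)
qed

lemma max_degree_star: "max_degree (star_plus n F) = 4"
  unfolding max_degree_def
proof (rule Max_eqI)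
  show "4 \<in> out_degree (with_proj (star_plus n F)) ` pverts (star_plus n F)"
    using n5 nbrs(1) by (intro image_eqI[of _ _ 0]) (auto simp: out_degree_with_proj)
qed (auto simp: out_degree_with_proj card_nbrs)

lemma lap_star_far: "5 \<le> a \<Longrightarrow> graph_lap (star_arcs \<union> F) f a = graph_lap F f a"
  by (simp add: graph_lap_def nbrs)

text \<open>Gershgorin's argument at an entry of largest modulus: twice the degree bound 4.\<close>

lemma eigen_le_8:
  assumes ev: "\<And>a. a < n \<Longrightarrow> graph_lap (star_arcs \<union> F) f a = l * f a"
    and "a < n" "f a \<noteq> 0"
  shows "l \<le> 8"
proof -
  define M where "M = Max ((\<lambda>a. \<bar>f a\<bar>) ` {0..<n})"
  have "M \<in> (\<lambda>a. \<bar>f a\<bar>) ` {0..<n}" unfolding M_def using assms(2) by (intro Max_in) auto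
  then obtain c where c: "c < n" "M = \<bar>f c\<bar>" by auto
  have le: "\<bar>f b\<bar> \<le> M" if "b < n" for b unfolding M_def using that by (intro Max_ge) auto
  have "M > 0" using le[OF assms(2)] assms(3) by simp
  have "\<bar>l\<bar> * M = \<bar>\<Sum>b\<in>(star_arcs \<union> F) `` {c}. f c - f b\<bar>"
    using ev[OF c(1)] c(2) by (simp add: graph_lap_def abs_mult)
  also have "\<dots> \<le> (\<Sum>b\<in>(star_arcs \<union> F) `` {c}. \<bar>f c - f b\<bar>)" by (rule sum_abs)
  also have "\<dots> \<le> (\<Sum>b\<in>(star_arcs \<union> F) `` {c}. 2 * M)"
  proof (rule sum_mono)
    fix b assume "b \<in> (star_arcs \<union> F) `` {c}"
    then have "b < n" using parcs_subset by auto
    then show "\<bar>f c - f b\<bar> \<le> 2 * M" using le[of b] le[OF c(1)] by linarith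
  qed
  also have "\<dots> \<le> 4 * (2 * M)"
    using card_nbrs[of c] \<open>M > 0\<close> by (simp add: mult_right_mono)
  finally have "\<bar>l\<bar> * M \<le> 8 * M" by simp
  then have "\<bar>l\<bar> \<le> 8" using \<open>M > 0\<close> by simp
  then show ?thesis by simp
qed

text \<open>An eigenvector supported on the star has non-zero eigenvalue 1 or 5, so a gap is asked
  only of vectors that do not vanish on the remaining vertices.\<close>

lemma condition_number_star:
  assumes K: "K \<ge> 1" and gap: "\<And>f l. l \<noteq> 0 \<Longrightarrow> (\<And>a. a \<in> {5..<n} \<Longrightarrow> graph_lap F f a = l * f a)
      \<Longrightarrow> (\<exists>a\<in>{5..<n}. f a \<noteq> 0) \<Longrightarrow> 1 / K \<le> l"
  shows "condition_number (laplacian (star_plus n F)) \<le> 8 * K"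
proof -
  let ?L = "laplacian (star_plus n F)" and ?E = "star_arcs \<union> F"
  have car: "?L \<in> carrier_mat n n" by (rule laplacian_carrier) simp
  have mult: "(?L *\<^sub>v vec n f) $ i = graph_lap ?E f i" if "i < n" for i f
    using laplacian_mult_vec[of "star_plus n F" n i f] that parcs_subset by simp
  define Sp where "Sp = spectrum ?L - {0}"
  have fin: "finite Sp" using card_finite_spectrum(1)[OF car] by (simp add: Sp_def)
  have bounds: "1 / K \<le> l \<and> l \<le> 8" if "l \<in> Sp" for l
  proof -
    have l: "l \<noteq> 0" "eigenvalue ?L l" using that by (auto simp: Sp_def spectrum_def)
    then obtain v where v: "v \<in> carrier_vec n" "v \<noteq> 0\<^sub>v n" "?L *\<^sub>v v = l \<cdot>\<^sub>v v"
      using car by (auto simp: eigenvalue_def eigenvector_def)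
    define f where "f i = v $ i" for i
    have vf: "v = vec n f" using v(1) by (auto simp: f_def)
    have ev: "graph_lap ?E f a = l * f a" if "a < n" for a
      using mult[OF that, of f] v(1,3) that vf by (metis carrier_vecD f_def index_smult_vec(1))
    obtain a where a: "a < n" "f a \<noteq> 0"
      using v(1,2) by (metis carrier_vecD eq_vecI f_def index_zero_vec(1,2))
    have "1 / K \<le> l"
    proof (cases "\<exists>a\<in>{5..<n}. f a \<noteq> 0")
      case True
      have "graph_lap F f a = l * f a" if "a \<in> {5..<n}" for a
        using ev[of a] that by (simp add: lap_star_far)
      from gap[OF l(1) this True] show ?thesis .
    next
      case False
      have leaf: "f i - f 0 = l * f i" if "i \<in> {1..4}" for i
        using ev[of i] that n5 nbrs(2)[OF that] by (simp add: graph_lap_def)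
      have "(\<Sum>b\<in>{1..4}. f 0 - f b) = l * f 0"
        using ev[of 0] n5 by (simp add: graph_lap_def nbrs)
      then have centre: "4 * f 0 - (f 1 + f 2 + f 3 + f 4) = l * f 0"
        by (simp add: numeral_eq_Suc atLeastAtMostSuc_conv)
      \<comment> \<open>Eliminating the leaf values \<open>f 0 / (1 - l)\<close> from the equation
        at the centre leaves \<open>f 0 * (l * (l - 5)) = 0\<close>.\<close>
      have "l = 1 \<or> l = 5"
      proof (rule ccontr)
        assume "\<not> ?thesis"
        then have l15: "l \<noteq> 1" "l \<noteq> 5" by auto
        have fi: "f i * (1 - l) = f 0" if "i \<in> {1..4}" for i
          using leaf[OF that] by (simp add: algebra_simps)
        define s where "s = f 1 + f 2 + f 3 + f 4"
        have "s * (1 - l) = 4 * f 0"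
          using fi[of 1] fi[of 2] fi[of 3] fi[of 4] by (simp add: s_def distrib_right)
        moreover have "(4 * f 0 - s) * (1 - l) = l * f 0 * (1 - l)"
          using centre by (simp add: s_def)
        ultimately have "4 * f 0 * (1 - l) - 4 * f 0 = l * f 0 * (1 - l)"
          by (simp only: left_diff_distrib)
        then have "f 0 * (l * (l - 5)) = 0"
          by (simp add: algebra_simps)
        then have "f 0 = 0" using l l15 by simp
        then have "f i = 0" if "i \<in> {1..4}" for i using fi[OF that] l15 by simp
        then have "f i = 0" if "i < n" for i
          using False \<open>f 0 = 0\<close> that by (cases "i = 0 \<or> i \<in> {1..4}") auto
        then show False using a by auto
      qed
      moreover have "1 / K \<le> 1" using K by simp
      ultimately show ?thesis by auto
    qed
    moreover have "l \<le> 8" using eigen_le_8[of f l a] ev a by blast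
    ultimately show ?thesis by simp
  qed
  have "1 \<in> Sp"
  proof -
    \<comment> \<open>The difference of two leaves of the star has eigenvalue 1, so
      \<open>Max\<close> and \<open>Min\<close> are taken over a non-empty set.\<close>
    define f :: "nat \<Rightarrow> real" where "f i = (if i = 1 then 1 else if i = 2 then - 1 else 0)" for i
    have "?L *\<^sub>v vec n f = 1 \<cdot>\<^sub>v vec n f"
    proof (rule eq_vecI)
      fix i assume "i < dim_vec (1 \<cdot>\<^sub>v vec n f)"
      then have i: "i < n" by simp
      consider "i = 0" | "i \<in> {1..4}" | "5 \<le> i" by force
      then have "graph_lap ?E f i = f i"
      proof cases
        case 1
        then show ?thesis by (simp add: graph_lap_def nbrs f_def numeral_eq_Suc atLeastAtMostSuc_conv)
      next
        case 2
        then show ?thesis by (simp add: graph_lap_def nbrs f_def)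
      next
        case 3
        then have "f b = 0" if "b \<in> F `` {i}" for b using that F(1) by (auto simp: f_def)
        with 3 show ?thesis by (simp add: graph_lap_def nbrs f_def)
      qed
      then show "(?L *\<^sub>v vec n f) $ i = (1 \<cdot>\<^sub>v vec n f) $ i"
        using mult[OF i, of f] i by simp
    qed (use car in auto)
    moreover have "vec n f \<noteq> 0\<^sub>v n"
    proof
      assume "vec n f = 0\<^sub>v n"
      then have "vec n f $ 1 = 0\<^sub>v n $ 1" by simp
      then show False using n5 by (simp add: f_def)
    qed
    ultimately have "eigenvector ?L (vec n f) 1" using car by (simp add: eigenvector_def)
    then show ?thesis by (auto simp: Sp_def spectrum_def eigenvalue_def)
  qed
  then have ne: "Sp \<noteq> {}" by auto
  have "Max Sp \<le> 8" using bounds fin ne by simp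
  moreover have "1 / K \<le> Min Sp" using bounds fin ne by simp
  moreover have "0 < 1 / K" using K by simp
  ultimately have "Max Sp / Min Sp \<le> 8 / (1 / K)"
    by (intro frac_le) auto
  then show ?thesis by (simp add: condition_number_def Sp_def)
qed

end

section \<open>De Bruijn averaging\<close>

lemma sum_double_interval:
  fixes g :: "nat \<Rightarrow> 'b::comm_monoid_add"
  shows "(\<Sum>w\<in>{2 * a..<2 * b}. g w) = (\<Sum>v\<in>{a..<b}. g (2 * v) + g (2 * v + 1))"
proof (cases "a \<le> b")
  case True
  then show ?thesis
  proof (induction b rule: dec_induct)
    case (step b)
    have "{2 * a..<2 * Suc b} = insert (2 * b + 1) (insert (2 * b) {2 * a..<2 * b})"
      using step.hyps by auto
    with step show ?case by (simp add: add_ac)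
  qed simp
qed simp

lemma sum_mod_double:
  fixes g :: "nat \<Rightarrow> real"
  shows "(\<Sum>z<2 * h. g (z mod h)) = 2 * (\<Sum>z<h. g z)"
proof -
  have "(\<Sum>z<2 * h. g (z mod h)) = (\<Sum>z\<in>{..<h} \<union> {h..<2 * h}. g (z mod h))"
    by (intro sum.cong) auto
  also have "\<dots> = (\<Sum>z<h. g (z mod h)) + (\<Sum>z\<in>{h..<2 * h}. g (z mod h))"
    by (intro sum.union_disjoint) auto
  also have "(\<Sum>z\<in>{h..<2 * h}. g (z mod h)) = (\<Sum>z<h. g z)"
    by (rule sum.reindex_bij_witness[of _ "\<lambda>z. z + h" "\<lambda>z. z - h"])
      (auto simp: mod_if)
  finally show ?thesis by simp
qed

text \<open>The weights suit an induction along a path: with \<open>t = j + 1\<close> the factors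
  \<open>(t + 1) / t\<close> telescope, so \<open>j\<close> edges cost a factor \<open>j + 1\<close>
  instead of an exponential one.\<close>

lemma square_add_le_weighted:
  fixes x y t :: real
  assumes "t > 0"
  shows "(x + y)\<^sup>2 \<le> (t + 1) / t * x\<^sup>2 + (t + 1) * y\<^sup>2"
proof -
  have "0 \<le> (x - t * y)\<^sup>2 / t" using assms by simp
  also have "\<dots> = (t + 1) / t * x\<^sup>2 + (t + 1) * y\<^sup>2 - (x + y)\<^sup>2"
    using assms by (simp add: field_simps power2_eq_square)
  finally show ?thesis by simp
qed

lemma half_square_diff_le:
  fixes x y z :: real
  shows "(x - y)\<^sup>2 / 2 \<le> (x - z)\<^sup>2 + (y - z)\<^sup>2"
proof -
  have "0 \<le> (x + y - 2 * z)\<^sup>2 / 2" by simp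
  also have "\<dots> = (x - z)\<^sup>2 + (y - z)\<^sup>2 - (x - y)\<^sup>2 / 2"
    by (simp add: field_simps power2_eq_square)
  finally show ?thesis by simp
qed

text \<open>For \<open>h = 2 ^ m\<close> and \<open>z < 2 * h\<close> this is the mean of
  \<open>g\<close> over the two successors of \<open>z\<close> in the de Bruijn graph on words of
  \<open>m + 1\<close> bits: drop the top bit and append either bit.\<close>

definition db_avg :: "nat \<Rightarrow> (nat \<Rightarrow> real) \<Rightarrow> nat \<Rightarrow> real" where
  "db_avg h g z = (g (2 * (z mod h)) + g (2 * (z mod h) + 1)) / 2"

text \<open>Convexity suffices for a contraction, since every vertex is a successor of exactly two
  vertices.\<close>

lemma sum_db_avg_square_le: "(\<Sum>z<2 * h. (db_avg h g z)\<^sup>2) \<le> (\<Sum>z<2 * h. (g z)\<^sup>2)"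
proof -
  have "(\<Sum>z<2 * h. (db_avg h g z)\<^sup>2) = 2 * (\<Sum>j<h. ((g (2 * j) + g (2 * j + 1)) / 2)\<^sup>2)"
    unfolding db_avg_def by (rule sum_mod_double[where g = "\<lambda>j. ((g (2 * j) + g (2 * j + 1)) / 2)\<^sup>2"])
  also have "\<dots> \<le> (\<Sum>j<h. (g (2 * j))\<^sup>2 + (g (2 * j + 1))\<^sup>2)"
    unfolding sum_distrib_left
  proof (rule sum_mono)
    fix j
    show "2 * ((g (2 * j) + g (2 * j + 1)) / 2)\<^sup>2 \<le> (g (2 * j))\<^sup>2 + (g (2 * j + 1))\<^sup>2"
      using half_square_diff_le[of "g (2 * j)" "- g (2 * j + 1)" 0] by (simp add: power_divide)
  qed
  also have "\<dots> = (\<Sum>z<2 * h. (g z)\<^sup>2)"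
    using sum_double_interval[of "\<lambda>z. (g z)\<^sup>2" 0 h] by (simp add: lessThan_atLeast0)
  finally show ?thesis .
qed

lemma sum_db_avg_iter_square_le: "(\<Sum>z<2 * h. ((db_avg h ^^ i) g z)\<^sup>2) \<le> (\<Sum>z<2 * h. (g z)\<^sup>2)"
  by (induction i) (auto intro: order_trans[OF sum_db_avg_square_le])

lemma db_avg_iter_diff:
  "(db_avg h ^^ i) (\<lambda>z. g z - g' z) = (\<lambda>z. (db_avg h ^^ i) g z - (db_avg h ^^ i) g' z)"
proof -
  have "db_avg h (\<lambda>z. a z - b z) = (\<lambda>z. db_avg h a z - db_avg h b z)" for a b
    by (simp add: db_avg_def fun_eq_iff diff_divide_distrib add_divide_distrib)
  then show ?thesis by (induction i) simp_all
qed

text \<open>Each application of the averaging operator shifts out one binary digit of its argument.\<close>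

lemma db_avg_iter_cong:
  assumes "k \<le> m" "x mod 2 ^ (m - k) = y mod 2 ^ (m - k)"
  shows "(db_avg (2 ^ m) ^^ Suc k) g x = (db_avg (2 ^ m) ^^ Suc k) g y"
  using assms
proof (induction k arbitrary: x y)
  case 0
  then show ?case by (simp add: db_avg_def)
next
  case (Suc k)
  have "(2 * (z mod 2 ^ m) + e) mod 2 ^ (m - k) = (2 * (z mod 2 ^ (m - Suc k)) + e) mod 2 ^ (m - k)"
    for z e :: nat
  proof -
    have e: "(2::nat) ^ (m - k) = 2 * 2 ^ (m - Suc k)"
      using Suc.prems(1) by (metis Suc_diff_Suc Suc_le_lessD power_Suc)
    have "z mod 2 ^ m mod 2 ^ (m - Suc k) = z mod 2 ^ (m - Suc k)"
      by (simp add: mod_mod_cancel le_imp_power_dvd)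
    then have "2 * (z mod 2 ^ m) mod 2 ^ (m - k) = 2 * (z mod 2 ^ (m - Suc k))"
      unfolding e mult_mod_right [symmetric] by simp
    then show ?thesis
      by (metis e mod_add_left_eq mod_mod_trivial mult_mod_right)
  qed
  then have "(2 * (x mod 2 ^ m) + e) mod 2 ^ (m - k) = (2 * (y mod 2 ^ m) + e) mod 2 ^ (m - k)" for e
    using Suc.prems(2) by simp
  from Suc.IH[OF _ this] Suc.prems(1)
  have "(db_avg (2 ^ m) ^^ Suc k) g (2 * (x mod 2 ^ m) + e)
      = (db_avg (2 ^ m) ^^ Suc k) g (2 * (y mod 2 ^ m) + e)" for e
    by simp
  from this[of 0] this[of 1] show ?case
    by (simp only: funpow.simps(2)[of "Suc k"] o_apply db_avg_def[of _ "(db_avg (2 ^ m) ^^ Suc k) g"] add_0_right)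
qed

text \<open>After \<open>m + 1\<close> averages all digits are shifted out and \<open>g\<close> has
  become a constant \<open>c\<close>. Hence \<open>g - c\<close> telescopes into
  \<open>m + 1\<close> iterated averages of the defect of \<open>g\<close> under one averaging, none
  of them longer than the defect itself; Cauchy-Schwarz gives the square.\<close>

lemma de_bruijn_poincare:
  fixes g :: "nat \<Rightarrow> real"
  shows "\<exists>c. (\<Sum>z<2 * 2 ^ m. (g z - c)\<^sup>2)
    \<le> (real m + 1)\<^sup>2 * (\<Sum>z<2 * 2 ^ m. (g z - db_avg (2 ^ m) g z)\<^sup>2)"
proof -
  define B where "B = db_avg (2 ^ m)"
  define d where "d = (\<lambda>z. g z - B g z)"
  define c where "c = (B ^^ Suc m) g 0"
  have "(B ^^ Suc m) g z = c" for z
    unfolding c_def B_def by (rule db_avg_iter_cong) auto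
  moreover have "g z - (B ^^ n) g z = (\<Sum>i<n. (B ^^ i) d z)" for n z
  proof (induction n)
    case (Suc n)
    have "(B ^^ n) d z = (B ^^ n) g z - (B ^^ Suc n) g z"
      unfolding d_def B_def by (simp add: db_avg_iter_diff funpow_swap1)
    with Suc show ?case by simp
  qed simp
  ultimately have gc: "g z - c = (\<Sum>i<Suc m. (B ^^ i) d z)" for z
    by metis
  have "(\<Sum>z<2 * 2 ^ m. (g z - c)\<^sup>2) \<le> (\<Sum>z<2 * 2 ^ m. (real m + 1) * (\<Sum>i<Suc m. ((B ^^ i) d z)\<^sup>2))"
  proof (rule sum_mono)
    fix z
    show "(g z - c)\<^sup>2 \<le> (real m + 1) * (\<Sum>i<Suc m. ((B ^^ i) d z)\<^sup>2)"
      using sum_squared_le_sum_of_squares[where I = "{..<Suc m}" and f = "\<lambda>i. (B ^^ i) d z"]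
      unfolding gc by (simp add: mult.commute add.commute)
  qed
  also have "\<dots> = (real m + 1) * (\<Sum>i<Suc m. \<Sum>z<2 * 2 ^ m. ((B ^^ i) d z)\<^sup>2)"
    unfolding sum_distrib_left [symmetric] by (subst sum.swap) (rule refl)
  also have "\<dots> \<le> (real m + 1) * (\<Sum>i<Suc m. \<Sum>z<2 * 2 ^ m. (d z)\<^sup>2)"
    unfolding B_def by (intro mult_left_mono sum_mono sum_db_avg_iter_square_le) auto
  also have "\<dots> = (real m + 1)\<^sup>2 * (\<Sum>z<2 * 2 ^ m. (d z)\<^sup>2)"
    by (simp add: power2_eq_square add.commute)
  finally show ?thesis unfolding d_def B_def by blast
qed

section \<open>The shuffled heap\<close>

locale shuffle_heap =
  fixes D :: nat
  assumes D: "1 \<le> D"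
begin

abbreviation "half \<equiv> (2::nat) ^ (2 * D - 1)"
abbreviation "leaves \<equiv> (2::nat) ^ (2 * D)"

text \<open>Heap numbering with everything above depth \<open>D\<close> cut off: the parent of
  \<open>w\<close> is \<open>w div 2\<close>, and level \<open>j\<close> consists of the numbers
  with \<open>D + j + 1\<close> binary digits. \<open>leaves\<close> is both the number of leaves
  and the index of the first one.\<close>

definition nodes :: "nat set" where "nodes = {2 ^ D..<2 ^ (2 * D + 1)}"
definition roots :: "nat set" where "roots = {2 ^ D..<2 ^ (D + 1)}"
definition level :: "nat \<Rightarrow> nat set" where "level j = {2 ^ (D + j)..<2 ^ (D + Suc j)}"

text \<open>Left rotation of words of \<open>2 * D\<close> bits. Of the two de Bruijn successors of
  \<open>z\<close> only this one is joined to \<open>z\<close>; the other is its tree sibling,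
  reachable through the common parent. One forward edge per leaf thus does the work of two.\<close>

definition shuffle :: "nat \<Rightarrow> nat" where "shuffle z = 2 * (z mod half) + z div half"

definition tree_arcs :: "(nat \<times> nat) set" where
  "tree_arcs = (\<lambda>w. (w, w div 2)) ` {2 ^ (D + 1)..<2 ^ (2 * D + 1)}"
definition shuffle_arcs :: "(nat \<times> nat) set" where
  "shuffle_arcs = (\<lambda>z. (leaves + z, leaves + shuffle z)) ` {z. z < leaves \<and> shuffle z \<noteq> z}"
definition leaf_arcs :: "(nat \<times> nat) set" where
  "leaf_arcs = shuffle_arcs \<union> shuffle_arcs\<inverse>"
definition heap_arcs :: "(nat \<times> nat) set" where
  "heap_arcs = tree_arcs \<union> tree_arcs\<inverse> \<union> leaf_arcs"

definition rise :: "(nat \<Rightarrow> real) \<Rightarrow> nat \<Rightarrow> real" where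
  "rise f w = f w - f (w div 2)"

definition tree_energy :: "nat \<Rightarrow> (nat \<Rightarrow> real) \<Rightarrow> real" where
  "tree_energy j f = (\<Sum>w\<in>{2 ^ (D + 1)..<2 ^ (D + Suc j)}. (rise f w)\<^sup>2)"

lemma leaves_half: "leaves = 2 * half"
  using D by (cases D) auto

lemma shuffle_less: "z < leaves \<Longrightarrow> shuffle z < leaves"
proof -
  assume z: "z < leaves"
  have "z mod half < half" by simp
  moreover have "z div half < 2" using z leaves_half by (simp add: less_mult_imp_div_less)
  ultimately show ?thesis unfolding shuffle_def leaves_half by linarith
qed

lemma roots_nodes: "roots \<subseteq> nodes"
  using power_increasing[of "D + 1" "2 * D + 1" "2::nat"] by (auto simp: roots_def nodes_def)

lemma leaf_in_nodes: "z < leaves \<Longrightarrow> leaves + z \<in> nodes"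
proof -
  assume "z < leaves"
  moreover have "(2::nat) ^ D \<le> leaves" by (rule power_increasing) auto
  then have "2 ^ D \<le> leaves + z" by (rule trans_le_add1)
  ultimately show ?thesis unfolding nodes_def by simp
qed

lemma div2_in_nodes: "w \<in> {2 ^ (D + 1)..<2 ^ (2 * D + 1)} \<Longrightarrow> w div 2 \<in> nodes"
  by (auto simp: nodes_def)

lemma heap_arcs_subset: "heap_arcs \<subseteq> nodes \<times> nodes"
proof -
  have "tree_arcs \<subseteq> nodes \<times> nodes"
    using div2_in_nodes by (auto simp: tree_arcs_def nodes_def)
  moreover have "shuffle_arcs \<subseteq> nodes \<times> nodes"
    using leaf_in_nodes shuffle_less by (auto simp: shuffle_arcs_def)
  ultimately show ?thesis unfolding heap_arcs_def leaf_arcs_def by blast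
qed

lemma finite_nodes [simp]: "finite nodes" by (simp add: nodes_def)

lemma finite_roots [simp]: "finite roots" by (simp add: roots_def)

lemma finite_arcs [simp]: "finite tree_arcs" "finite shuffle_arcs" "finite leaf_arcs" "finite heap_arcs"
  by (auto simp: tree_arcs_def shuffle_arcs_def leaf_arcs_def heap_arcs_def)

lemma sym_heap_arcs: "sym heap_arcs"
  by (auto simp: sym_def heap_arcs_def leaf_arcs_def)

lemma shuffle_arc_ge: "(a, b) \<in> leaf_arcs \<Longrightarrow> leaves \<le> a \<and> leaves \<le> b"
  by (auto simp: leaf_arcs_def shuffle_arcs_def)

lemma tree_arc_less:
  assumes "(a, b) \<in> tree_arcs"
  shows "b < leaves" "b < a"
proof -
  have a: "b = a div 2" "2 ^ (D + 1) \<le> a" "a < 2 ^ (2 * D + 1)"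
    using assms by (auto simp: tree_arcs_def)
  have "(0::nat) < 2 ^ (D + 1)" by simp
  then have "0 < a" using a(2) by (rule less_le_trans)
  then show "b < a" using a(1) by simp
  show "b < leaves" using a by simp
qed

lemma irrefl_heap_arcs: "irrefl heap_arcs"
  using tree_arc_less(2) by (fastforce simp: irrefl_def heap_arcs_def leaf_arcs_def shuffle_arcs_def)

lemma sum_tree_arcs: "(\<Sum>(a, b)\<in>tree_arcs. g a b) = (\<Sum>w\<in>{2 ^ (D + 1)..<2 ^ (2 * D + 1)}. g w (w div 2))"
  unfolding tree_arcs_def by (subst sum.reindex) (auto simp: inj_on_def)

lemma dirichlet_heap:
  "dirichlet_form heap_arcs f g
    = (\<Sum>w\<in>{2 ^ (D + 1)..<2 ^ (2 * D + 1)}. rise f w * rise g w) + dirichlet_form leaf_arcs f g"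
proof -
  let ?h = "\<lambda>(a, b). (f a - f b) * (g a - g b)"
  have disj: "(tree_arcs \<union> tree_arcs\<inverse>) \<inter> leaf_arcs = {}" "tree_arcs \<inter> tree_arcs\<inverse> = {}"
  proof -
    have "p \<notin> leaf_arcs" if "p \<in> tree_arcs \<union> tree_arcs\<inverse>" for p
    proof (cases p)
      case (Pair a b)
      with that have "a < leaves \<or> b < leaves" using tree_arc_less(1) by blast
      with Pair show ?thesis using shuffle_arc_ge[of a b] by (metis not_less)
    qed
    then show "(tree_arcs \<union> tree_arcs\<inverse>) \<inter> leaf_arcs = {}" by blast
    have "(b, a) \<notin> tree_arcs" if "(a, b) \<in> tree_arcs" for a b
      using tree_arc_less(2)[OF that] tree_arc_less(2)[of b a] by linarith
    then show "tree_arcs \<inter> tree_arcs\<inverse> = {}" by auto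
  qed
  have "sum ?h heap_arcs = sum ?h (tree_arcs \<union> tree_arcs\<inverse>) + sum ?h leaf_arcs"
    unfolding heap_arcs_def
    using disj(1) by (intro sum.union_disjoint) auto
  also have "sum ?h (tree_arcs \<union> tree_arcs\<inverse>) = sum ?h tree_arcs + sum ?h (tree_arcs\<inverse>)"
    using disj(2) by (intro sum.union_disjoint) auto
  also have "sum ?h (tree_arcs\<inverse>) = sum ?h tree_arcs"
    by (rule sum.reindex_bij_witness[of _ prod.swap prod.swap]) (auto simp: algebra_simps)
  finally show ?thesis
    unfolding dirichlet_form_def sum_tree_arcs[of "\<lambda>a b. (f a - f b) * (g a - g b)"]
    by (simp add: rise_def)
qed

section \<open>Energy inequalities on the heap\<close>

lemma tree_energy_le: "tree_energy D f \<le> dirichlet_form heap_arcs f f"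
proof -
  have "tree_energy D f = (\<Sum>w\<in>{2 ^ (D + 1)..<2 ^ (2 * D + 1)}. rise f w * rise f w)"
    by (simp add: tree_energy_def power2_eq_square mult_2[of D])
  then show ?thesis using dirichlet_form_nonneg[of leaf_arcs f] by (simp add: dirichlet_heap)
qed

text \<open>The factor 2 is due to the 2-cycles of the shuffle: such an edge is met from both of its
  ends on the left, yet it is a single edge of the graph.\<close>

lemma shuffle_energy_le:
  "(\<Sum>z<leaves. (f (leaves + z) - f (leaves + shuffle z))\<^sup>2)
    \<le> 2 * (dirichlet_form heap_arcs f f - tree_energy D f)"
proof -
  have "(\<Sum>z<leaves. (f (leaves + z) - f (leaves + shuffle z))\<^sup>2)
      = (\<Sum>z\<in>{z. z < leaves \<and> shuffle z \<noteq> z}. (f (leaves + z) - f (leaves + shuffle z))\<^sup>2)"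
    by (intro sum.mono_neutral_right) auto
  also have "\<dots> = (\<Sum>(a, b)\<in>shuffle_arcs. (f a - f b) * (f a - f b))"
    unfolding shuffle_arcs_def by (subst sum.reindex) (auto simp: inj_on_def power2_eq_square)
  also have "\<dots> \<le> (\<Sum>(a, b)\<in>leaf_arcs. (f a - f b) * (f a - f b))"
    by (intro sum_mono2) (auto simp: leaf_arcs_def)
  also have "\<dots> = 2 * dirichlet_form leaf_arcs f f"
    by (simp add: dirichlet_form_def)
  finally show ?thesis
    by (simp add: dirichlet_heap tree_energy_def power2_eq_square mult_2[of D])
qed

lemma tree_energy_Suc: "tree_energy (Suc j) f = tree_energy j f + (\<Sum>w\<in>level (Suc j). (rise f w)\<^sup>2)"
  unfolding tree_energy_def level_def
  by (rule sum.atLeastLessThan_concat [symmetric]; rule power_increasing) auto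

lemma tree_energy_0 [simp]: "tree_energy 0 f = 0"
  by (simp add: tree_energy_def)

lemma sum_nodes_levels: "(\<Sum>w\<in>nodes. g w) = (\<Sum>j\<le>D. \<Sum>w\<in>level j. g w)"
proof -
  have "(\<Sum>w\<in>{2 ^ D..<2 ^ (D + Suc j)}. g w) = (\<Sum>i\<le>j. \<Sum>w\<in>level i. g w)" for j
  proof (induction j)
    case 0
    then show ?case by (simp add: level_def)
  next
    case (Suc j)
    have "(\<Sum>w\<in>{2 ^ D..<2 ^ (D + Suc (Suc j))}. g w)
        = (\<Sum>w\<in>{2 ^ D..<2 ^ (D + Suc j)}. g w) + (\<Sum>w\<in>level (Suc j). g w)"
      unfolding level_def
      by (rule sum.atLeastLessThan_concat [symmetric]; rule power_increasing) auto
    with Suc show ?case by simp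
  qed
  from this[of D] show ?thesis by (simp add: nodes_def mult_2[of D])
qed

lemma sum_level_Suc: "(\<Sum>w\<in>level (Suc j). g w) = (\<Sum>v\<in>level j. g (2 * v) + g (2 * v + 1))"
  using sum_double_interval[of g "2 ^ (D + j)" "2 ^ (D + Suc j)"] by (simp add: level_def)

lemma level_0: "level 0 = roots"
  by (simp add: level_def roots_def)

text \<open>Cauchy-Schwarz for the root value and the \<open>j\<close> rises on the path down to
  \<open>w\<close>, where each rise is bounded by the energy of its whole level.\<close>

lemma node_square_le_path:
  "w \<in> level j \<Longrightarrow> (f w)\<^sup>2 \<le> (real j + 1) * ((\<Sum>r\<in>roots. (f r)\<^sup>2) + tree_energy j f)"
proof (induction j arbitrary: w)
  case 0
  then show ?case by (auto simp: level_0 intro: member_le_sum)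
next
  case (Suc j)
  let ?M = "\<Sum>r\<in>roots. (f r)\<^sup>2"
  have "w div 2 \<in> level j" using Suc.prems by (auto simp: level_def)
  note IH = Suc.IH[OF this]
  have "(f w)\<^sup>2 = (f (w div 2) + rise f w)\<^sup>2" by (simp add: rise_def)
  also have "\<dots> \<le> (real j + 2) / (real j + 1) * (f (w div 2))\<^sup>2 + (real j + 2) * (rise f w)\<^sup>2"
    using square_add_le_weighted[of "real j + 1" "f (w div 2)" "rise f w"] by (simp add: add.assoc)
  also have "\<dots> \<le> (real j + 2) / (real j + 1) * ((real j + 1) * (?M + tree_energy j f))
      + (real j + 2) * (\<Sum>w\<in>level (Suc j). (rise f w)\<^sup>2)"
    using IH Suc.prems by (intro add_mono mult_left_mono member_le_sum) (auto simp: level_def)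
  also have "(real j + 2) / (real j + 1) * ((real j + 1) * (?M + tree_energy j f))
      = (real j + 2) * (?M + tree_energy j f)"
    by simp
  also have "\<dots> + (real j + 2) * (\<Sum>w\<in>level (Suc j). (rise f w)\<^sup>2)
      = (real (Suc j) + 1) * (?M + tree_energy (Suc j) f)"
    by (simp add: tree_energy_Suc algebra_simps)
  finally show ?case .
qed

text \<open>The path estimate summed over a level: a root value is shared by its
  \<open>2 ^ j\<close> descendants there. This loss is the source of the gap of order
  \<open>2 ^ - D\<close> up to powers of \<open>D\<close>.\<close>

lemma level_square_le_root:
  "(\<Sum>w\<in>level j. (f w)\<^sup>2) \<le> (real j + 1) * 2 ^ j * ((\<Sum>r\<in>roots. (f r)\<^sup>2) + tree_energy j f)"
proof (induction j)
  case 0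
  then show ?case by (simp add: level_0)
next
  case (Suc j)
  let ?M = "\<Sum>r\<in>roots. (f r)\<^sup>2" and ?U = "\<Sum>w\<in>level (Suc j). (rise f w)\<^sup>2"
  have "(\<Sum>w\<in>level (Suc j). (f w)\<^sup>2)
      \<le> (\<Sum>w\<in>level (Suc j). (real j + 2) / (real j + 1) * (f (w div 2))\<^sup>2 + (real j + 2) * (rise f w)\<^sup>2)"
  proof (rule sum_mono)
    fix w
    have "(f w)\<^sup>2 = (f (w div 2) + rise f w)\<^sup>2" by (simp add: rise_def)
    then show "(f w)\<^sup>2 \<le> (real j + 2) / (real j + 1) * (f (w div 2))\<^sup>2 + (real j + 2) * (rise f w)\<^sup>2"
      using square_add_le_weighted[of "real j + 1" "f (w div 2)" "rise f w"] by (simp add: add.assoc)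
  qed
  also have "\<dots> = (real j + 2) / (real j + 1) * (\<Sum>w\<in>level (Suc j). (f (w div 2))\<^sup>2) + (real j + 2) * ?U"
    by (simp only: sum.distrib sum_distrib_left)
  also have "(\<Sum>w\<in>level (Suc j). (f (w div 2))\<^sup>2) = 2 * (\<Sum>v\<in>level j. (f v)\<^sup>2)"
    by (simp add: sum_level_Suc sum_distrib_left)
  also have "(real j + 2) / (real j + 1) * (2 * (\<Sum>v\<in>level j. (f v)\<^sup>2)) + (real j + 2) * ?U
      \<le> (real j + 2) / (real j + 1) * (2 * ((real j + 1) * 2 ^ j * (?M + tree_energy j f)))
        + (real j + 2) * (2 ^ Suc j * ?U)"
  proof (intro add_mono mult_left_mono)
    have "(1::real) \<le> 2 ^ Suc j" by (rule one_le_power) simp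
    from mult_right_mono[OF this, of ?U] show "?U \<le> 2 ^ Suc j * ?U"
      by (simp only: mult_1 sum_nonneg zero_le_power2)
  qed (use Suc in auto)
  also have "(real j + 2) / (real j + 1) * (2 * ((real j + 1) * 2 ^ j * (?M + tree_energy j f)))
      = (real j + 2) * 2 ^ Suc j * (?M + tree_energy j f)"
    by simp
  also have "\<dots> + (real j + 2) * (2 ^ Suc j * ?U) = (real (Suc j) + 1) * 2 ^ Suc j * (?M + tree_energy (Suc j) f)"
    by (simp add: tree_energy_Suc algebra_simps)
  finally show ?case .
qed

lemma tree_energy_mono: "j \<le> i \<Longrightarrow> tree_energy j f \<le> tree_energy i f"
proof (induction i rule: dec_induct)
  case (step i)
  have "0 \<le> (\<Sum>w\<in>level (Suc i). (rise f w)\<^sup>2)" by (intro sum_nonneg) auto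
  with step.IH show ?case by (simp add: tree_energy_Suc)
qed simp

lemma nodes_square_le:
  "(\<Sum>w\<in>nodes. (f w)\<^sup>2) \<le> (real D + 1)\<^sup>2 * 2 ^ D * ((\<Sum>r\<in>roots. (f r)\<^sup>2) + dirichlet_form heap_arcs f f)"
proof -
  let ?M = "\<Sum>r\<in>roots. (f r)\<^sup>2" and ?E = "dirichlet_form heap_arcs f f"
  have "(\<Sum>w\<in>nodes. (f w)\<^sup>2) \<le> (\<Sum>j\<le>D. (real D + 1) * 2 ^ D * (?M + ?E))"
    unfolding sum_nodes_levels
  proof (rule sum_mono)
    fix j assume j: "j \<in> {..D}"
    have "(\<Sum>w\<in>level j. (f w)\<^sup>2) \<le> (real j + 1) * 2 ^ j * (?M + tree_energy j f)"
      by (rule level_square_le_root)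
    also have "\<dots> \<le> (real D + 1) * 2 ^ D * (?M + ?E)"
      using j tree_energy_mono[of j D f] tree_energy_le[of f] tree_energy_mono[of 0 j f]
      by (intro mult_mono add_mono power_increasing) (auto intro!: add_nonneg_nonneg sum_nonneg)
    finally show "(\<Sum>w\<in>level j. (f w)\<^sup>2) \<le> (real D + 1) * 2 ^ D * (?M + ?E)" .
  qed
  then show ?thesis by (simp add: power2_eq_square algebra_simps)
qed

lemma node_square_le:
  assumes "w \<in> nodes"
  shows "(f w)\<^sup>2 \<le> (real D + 1) * ((\<Sum>r\<in>roots. (f r)\<^sup>2) + dirichlet_form heap_arcs f f)"
proof -
  let ?M = "\<Sum>r\<in>roots. (f r)\<^sup>2" and ?E = "dirichlet_form heap_arcs f f"
  define j where "j = floor_log w - D"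
  have w: "w > 0" "2 ^ D \<le> w" "w < 2 ^ (2 * D + 1)"
    using assms by (auto simp: nodes_def intro: order_less_le_trans[of 0 "2 ^ D"])
  have "D \<le> floor_log w"
    using floor_log_le_iff[OF w(2)] by simp
  moreover have "floor_log w < 2 * D + 1"
  proof (rule ccontr)
    assume "\<not> ?thesis"
    then have "2 ^ (2 * D + 1) \<le> (2::nat) ^ floor_log w" by (intro power_increasing) auto
    also have "\<dots> \<le> w" using w(1) by (rule floor_log_exp2_le)
    finally show False using w(3) by simp
  qed
  ultimately have j: "j \<le> D" "floor_log w = D + j" by (auto simp: j_def)
  have "w \<in> level j"
    using floor_log_exp2_le[OF w(1)] floor_log_exp2_gt[of w] j(2) by (auto simp: level_def)
  from node_square_le_path[OF this]
  have "(f w)\<^sup>2 \<le> (real j + 1) * (?M + tree_energy j f)" .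
  also have "\<dots> \<le> (real D + 1) * (?M + ?E)"
    using j tree_energy_mono[of j D f] tree_energy_le[of f] tree_energy_mono[of 0 j f]
    by (intro mult_mono add_mono) (auto intro!: add_nonneg_nonneg sum_nonneg)
  finally show ?thesis .
qed

text \<open>Upwards there is no loss: half of \<open>(f v - c)\<^sup>2\<close> is charged to each of
  the two children of \<open>v\<close> and to the edge leading there, and that edge energy leaves
  \<open>tree_energy\<close> as the level rises.\<close>

lemma level_square_le_leaves:
  assumes "j \<le> D"
  shows "(\<Sum>w\<in>level j. (f w - c)\<^sup>2) + tree_energy j f \<le> (\<Sum>w\<in>level D. (f w - c)\<^sup>2) + tree_energy D f"
  using assms
proof (induction j rule: inc_induct)
  case (step j)
  have "(\<Sum>v\<in>level j. (f v - c)\<^sup>2)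
      \<le> (\<Sum>w\<in>level (Suc j). (f w - c)\<^sup>2) + (\<Sum>w\<in>level (Suc j). (rise f w)\<^sup>2)"
    unfolding sum_level_Suc sum.distrib [symmetric]
  proof (rule sum_mono)
    fix v
    have "(f v - c)\<^sup>2 / 2 \<le> (f w - c)\<^sup>2 + (f w - f v)\<^sup>2" for w
      using half_square_diff_le[of "f v" c "f w"] by (simp add: power2_commute)
    from this[of "2 * v"] this[of "2 * v + 1"]
    show "(f v - c)\<^sup>2 \<le> (f (2 * v) - c)\<^sup>2 + (f (2 * v + 1) - c)\<^sup>2
        + ((rise f (2 * v))\<^sup>2 + (rise f (2 * v + 1))\<^sup>2)"
      by (simp add: rise_def)
  qed
  with step.IH show ?case by (simp add: tree_energy_Suc)
qed simp

lemma sum_level_D: "(\<Sum>w\<in>level D. g w) = (\<Sum>z<leaves. g (leaves + z))"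
  by (rule sum.reindex_bij_witness[of _ "\<lambda>z. leaves + z" "\<lambda>w. w - leaves"])
    (auto simp: level_def mult_2[of D])

text \<open>One of the two successors of \<open>z\<close> is \<open>shuffle z\<close>, and the other
  is two tree edges away from it. The defect under de Bruijn averaging is therefore controlled by
  edge energies, at a total cost of 4; the word length \<open>2 * D\<close> contributes
  \<open>(2 * D)^2\<close>.\<close>

lemma leaf_poincare:
  "\<exists>c. (\<Sum>z<leaves. (f (leaves + z) - c)\<^sup>2) \<le> 16 * (real D)\<^sup>2 * dirichlet_form heap_arcs f f"
proof -
  define g where "g z = f (leaves + z)" for z
  let ?E = "dirichlet_form heap_arcs f f"
  have "(g z - db_avg half g z)\<^sup>2 \<le> 2 * (g z - g (shuffle z))\<^sup>2
      + ((rise f (leaves + 2 * (z mod half)))\<^sup>2 + (rise f (leaves + (2 * (z mod half) + 1)))\<^sup>2)"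
    if "z < 2 * half" for z
  proof -
    define j where "j = z mod half"
    have "z div half < 2" using that by (simp add: less_mult_imp_div_less)
    then have "shuffle z = 2 * j \<or> shuffle z = 2 * j + 1"
      by (auto simp: shuffle_def j_def)
    moreover have avg: "db_avg half g z = (g (2 * j) + g (2 * j + 1)) / 2"
      by (simp only: db_avg_def j_def)
    ultimately have "(g (shuffle z) - db_avg half g z)\<^sup>2 = (g (2 * j) - g (2 * j + 1))\<^sup>2 / 4"
      unfolding avg by (auto simp: field_simps power2_eq_square)
    moreover have "(g (2 * j) - g (2 * j + 1))\<^sup>2 / 2
        \<le> (rise f (leaves + 2 * j))\<^sup>2 + (rise f (leaves + (2 * j + 1)))\<^sup>2"
    proof -
      have "(leaves + 2 * j) div 2 = half + j" "(leaves + (2 * j + 1)) div 2 = half + j"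
        unfolding leaves_half by auto
      then show ?thesis
        using half_square_diff_le[of "g (2 * j)" "g (2 * j + 1)" "f (half + j)"]
        by (simp only: rise_def g_def)
    qed
    moreover have "(g z - db_avg half g z)\<^sup>2
        \<le> 2 * (g z - g (shuffle z))\<^sup>2 + 2 * (g (shuffle z) - db_avg half g z)\<^sup>2"
      using half_square_diff_le[of "g z" "db_avg half g z" "g (shuffle z)"] by (simp add: power2_commute)
    ultimately show ?thesis unfolding j_def [symmetric] by linarith
  qed
  then have "(\<Sum>z<2 * half. (g z - db_avg half g z)\<^sup>2) \<le> (\<Sum>z<2 * half. 2 * (g z - g (shuffle z))\<^sup>2
      + ((rise f (leaves + 2 * (z mod half)))\<^sup>2 + (rise f (leaves + (2 * (z mod half) + 1)))\<^sup>2))"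
    by (intro sum_mono) simp
  also have "\<dots> = 2 * (\<Sum>z<2 * half. (g z - g (shuffle z))\<^sup>2)
      + 2 * (\<Sum>j<half. (rise f (leaves + 2 * j))\<^sup>2 + (rise f (leaves + (2 * j + 1)))\<^sup>2)"
    by (simp only: sum.distrib sum_distrib_left [symmetric]
        sum_mod_double[where g = "\<lambda>j. (rise f (leaves + 2 * j))\<^sup>2"]
        sum_mod_double[where g = "\<lambda>j. (rise f (leaves + (2 * j + 1)))\<^sup>2"] distrib_left)
  also have "(\<Sum>j<half. (rise f (leaves + 2 * j))\<^sup>2 + (rise f (leaves + (2 * j + 1)))\<^sup>2)
      = (\<Sum>z<2 * half. (rise f (leaves + z))\<^sup>2)"
    using sum_double_interval[of "\<lambda>z. (rise f (leaves + z))\<^sup>2" 0 half] by (simp add: lessThan_atLeast0)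
  also have "\<dots> = (\<Sum>w\<in>level D. (rise f w)\<^sup>2)"
    by (simp only: sum_level_D leaves_half [symmetric])
  also have "\<dots> \<le> tree_energy D f"
    using tree_energy_Suc[of "D - 1" f] tree_energy_mono[of 0 "D - 1" f] D by simp
  also have "(\<Sum>z<2 * half. (g z - g (shuffle z))\<^sup>2) \<le> 2 * (?E - tree_energy D f)"
    using shuffle_energy_le[of f] unfolding g_def leaves_half [symmetric] .
  \<comment> \<open>With \<open>T = tree_energy D f\<close> the two parts are at most
    \<open>2 * 2 * (E - T)\<close> and \<open>2 * T\<close>, and \<open>T\<close> is
    non-negative.\<close>
  finally have step: "(\<Sum>z<2 * half. (g z - db_avg half g z)\<^sup>2) \<le> 4 * ?E"
    using tree_energy_mono[of 0 D f] by simp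
  obtain c where "(\<Sum>z<2 * half. (g z - c)\<^sup>2)
      \<le> (real (2 * D - 1) + 1)\<^sup>2 * (\<Sum>z<2 * half. (g z - db_avg half g z)\<^sup>2)"
    using de_bruijn_poincare[where m = "2 * D - 1" and g = g] by blast
  also have "\<dots> \<le> (real (2 * D - 1) + 1)\<^sup>2 * (4 * ?E)"
    using step by (intro mult_left_mono) auto
  also have "real (2 * D - 1) + 1 = 2 * real D" using D by (simp add: of_nat_diff)
  also have "(2 * real D)\<^sup>2 * (4 * ?E) = 16 * (real D)\<^sup>2 * ?E" by (simp add: power_mult_distrib)
  finally show ?thesis
    unfolding g_def leaves_half [symmetric] by blast
qed

text \<open>The leaf inequality is carried upwards with the same centre \<open>c\<close>; only the
  number of levels is lost, so this constant stays polynomial in \<open>D\<close>.\<close>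

lemma nodes_poincare:
  "\<exists>c. (\<Sum>w\<in>nodes. (f w - c)\<^sup>2) \<le> (real D + 1) * (16 * (real D)\<^sup>2 + 1) * dirichlet_form heap_arcs f f"
proof -
  let ?E = "dirichlet_form heap_arcs f f"
  obtain c where c: "(\<Sum>z<leaves. (f (leaves + z) - c)\<^sup>2) \<le> 16 * (real D)\<^sup>2 * ?E"
    using leaf_poincare[of f] by blast
  have "(\<Sum>w\<in>nodes. (f w - c)\<^sup>2) \<le> (\<Sum>j\<le>D. 16 * (real D)\<^sup>2 * ?E + ?E)"
    unfolding sum_nodes_levels
  proof (rule sum_mono)
    fix j assume "j \<in> {..D}"
    then show "(\<Sum>w\<in>level j. (f w - c)\<^sup>2) \<le> 16 * (real D)\<^sup>2 * ?E + ?E"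
      using level_square_le_leaves[of j f c] tree_energy_mono[of 0 j f] tree_energy_le[of f] c
      by (simp add: sum_level_D)
  qed
  also have "\<dots> = (real D + 1) * (16 * (real D)\<^sup>2 + 1) * ?E"
    by (simp add: algebra_simps)
  finally show ?thesis by blast
qed

section \<open>The response to a uniform demand\<close>

definition mean_potential :: "nat \<Rightarrow> real" where
  "mean_potential w = 3 / 2 * 2 ^ D - 2 ^ (2 * D - floor_log w)"

text \<open>
  The potential of the flow that injects one unit at every leaf and drains each tree through its
  root across an edge of conductance 2; it is constant on every level, so the shuffle edges carry
  no flow.
\<close>

lemma mean_potential_weak:
  "dirichlet_form heap_arcs f mean_potential + 2 * (\<Sum>r\<in>roots. f r * mean_potential r)
    = (\<Sum>z<leaves. f (leaves + z))"
proof -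
  let ?p = "\<lambda>w. 2 ^ (2 * D - floor_log w) :: real"
  have lev: "floor_log w = D + j" if "w \<in> level j" for w j
    using that by (intro floor_log_eqI) (auto simp: level_def intro: order_less_le_trans[of 0 "2 ^ (D + j)"])
  have leaf: "floor_log (leaves + z) = 2 * D" if "z < leaves" for z
    using that by (intro floor_log_eqI) auto
  have "dirichlet_form leaf_arcs f mean_potential = 0"
    unfolding dirichlet_form_def
    by (auto intro!: sum.neutral simp: leaf_arcs_def shuffle_arcs_def mean_potential_def leaf shuffle_less)
  \<comment> \<open>The rise above \<open>w\<close> is the number of leaves below \<open>w\<close>,
    the current carried by that edge.\<close>
  moreover have "rise mean_potential w = ?p w" if "w \<in> {2 ^ (D + 1)..<2 ^ (2 * D + 1)}" for w
  proof -
    have "w \<ge> 2 ^ (D + 1)" "(2::nat) ^ (D + 1) \<ge> 2" using that by auto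
    then have "w \<ge> 2" by linarith
    then have "floor_log w = Suc (floor_log (w div 2))" by (rule floor_log_rec)
    moreover have "w div 2 < 2 ^ (2 * D)" "w div 2 > 0" using that \<open>w \<ge> 2\<close> by auto
    then have "floor_log (w div 2) < 2 * D"
      by (metis floor_log_exp2_le le_less_trans nat_power_less_imp_less pos2)
    then have "2 * D - floor_log (w div 2) = Suc (2 * D - Suc (floor_log (w div 2)))" by simp
    ultimately show ?thesis by (simp add: rise_def mean_potential_def)
  qed
  ultimately have "dirichlet_form heap_arcs f mean_potential
      = (\<Sum>w\<in>{2 ^ (D + 1)..<2 ^ (2 * D + 1)}. rise f w * ?p w)"
    unfolding dirichlet_heap by simp
  also have "\<dots> = (\<Sum>w\<in>{2 ^ (D + 1)..<2 ^ (2 * D + 1)}. f w * ?p w)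
      - (\<Sum>w\<in>{2 ^ (D + 1)..<2 ^ (2 * D + 1)}. f (w div 2) * ?p w)"
    by (simp add: rise_def sum_subtractf left_diff_distrib)
  also have "(\<Sum>w\<in>{2 ^ (D + 1)..<2 ^ (2 * D + 1)}. f (w div 2) * ?p w)
      = (\<Sum>v\<in>{2 ^ D..<2 ^ (2 * D)}. f v * ?p (2 * v) + f v * ?p (2 * v + 1))"
    using sum_double_interval[of "\<lambda>w. f (w div 2) * ?p w" "2 ^ D" "2 ^ (2 * D)"] by simp
  \<comment> \<open>Conservation of current: the two edges below \<open>v\<close> together carry
    what the edge above \<open>v\<close> carries. Only leaves and roots survive.\<close>
  also have "\<dots> = (\<Sum>v\<in>{2 ^ D..<2 ^ (2 * D)}. f v * ?p v)"
  proof (rule sum.cong [OF refl])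
    fix v :: nat assume v: "v \<in> {2 ^ D..<2 ^ (2 * D)}"
    then have v0: "v > 0" by (auto intro: order_less_le_trans[of 0 "2 ^ D"])
    then have "floor_log (2 * v) = Suc (floor_log v)" "floor_log (2 * v + 1) = Suc (floor_log v)"
      by (auto simp: floor_log_rec)
    moreover have "floor_log v < 2 * D"
      using v v0 by (metis atLeastLessThan_iff floor_log_exp2_le le_less_trans nat_power_less_imp_less pos2)
    then have "2 * D - floor_log v = Suc (2 * D - Suc (floor_log v))" by simp
    ultimately show "f v * ?p (2 * v) + f v * ?p (2 * v + 1) = f v * ?p v" by simp
  qed
  also have "(\<Sum>w\<in>{2 ^ (D + 1)..<2 ^ (2 * D + 1)}. f w * ?p w) - (\<Sum>v\<in>{2 ^ D..<2 ^ (2 * D)}. f v * ?p v)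
      = (\<Sum>w\<in>level D. f w * ?p w) - (\<Sum>r\<in>roots. f r * ?p r)"
  proof -
    have "(\<Sum>w\<in>{2 ^ D..<2 ^ (D + 1)}. f w * ?p w) + (\<Sum>w\<in>{2 ^ (D + 1)..<2 ^ (2 * D + 1)}. f w * ?p w)
        = (\<Sum>w\<in>{2 ^ D..<2 ^ (2 * D + 1)}. f w * ?p w)"
      by (rule sum.atLeastLessThan_concat) (auto intro: power_increasing simp del: power_Suc)
    moreover have "(\<Sum>w\<in>{2 ^ D..<2 ^ (2 * D)}. f w * ?p w) + (\<Sum>w\<in>{2 ^ (2 * D)..<2 ^ (2 * D + 1)}. f w * ?p w)
        = (\<Sum>w\<in>{2 ^ D..<2 ^ (2 * D + 1)}. f w * ?p w)"
      by (rule sum.atLeastLessThan_concat) (auto intro: power_increasing simp del: power_Suc)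
    ultimately show ?thesis by (simp add: level_def roots_def mult_2[of D])
  qed
  also have "(\<Sum>w\<in>level D. f w * ?p w) = (\<Sum>z<leaves. f (leaves + z))"
    unfolding sum_level_D by (intro sum.cong) (auto simp: leaf)
  also have "(\<Sum>r\<in>roots. f r * ?p r) = 2 * (\<Sum>r\<in>roots. f r * mean_potential r)"
    unfolding sum_distrib_left using lev[of _ 0]
    by (intro sum.cong) (auto simp: level_0 mean_potential_def mult_2[of D])
  finally show ?thesis by simp
qed

text \<open>The \<open>2 ^ D\<close> units injected into a tree leave through conductance 2.\<close>

lemma mean_potential_root: "r \<in> roots \<Longrightarrow> mean_potential r = 2 ^ D / 2"
proof -
  assume "r \<in> roots"
  then have "floor_log r = D"
    by (intro floor_log_eqI) (auto simp: roots_def intro: order_less_le_trans[of 0 "2 ^ D"])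
  then show ?thesis by (simp add: mean_potential_def mult_2[of D])
qed

text \<open>To the root value \<open>2 ^ D / 2\<close> a path adds the rises
  \<open>2 ^ (D - 1)\<close>, \<open>2 ^ (D - 2)\<close> and so on, less than \<open>2 ^ D\<close>
  in all.\<close>

lemma mean_potential_bounds:
  assumes "w \<in> nodes"
  shows "0 \<le> mean_potential w" "mean_potential w \<le> 3 / 2 * 2 ^ D"
proof -
  have "D \<le> floor_log w"
    using assms floor_log_le_iff[of "2 ^ D" w] by (auto simp: nodes_def)
  then have "(2::real) ^ (2 * D - floor_log w) \<le> 2 ^ D" by (intro power_increasing) auto
  moreover have "(0::real) < 2 ^ D" "(0::real) < 2 ^ (2 * D - floor_log w)" by simp_all
  ultimately show "0 \<le> mean_potential w" "mean_potential w \<le> 3 / 2 * 2 ^ D"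
    unfolding mean_potential_def by linarith+
qed

end

section \<open>Green functions\<close>

lemma injective_kernel_solvable:
  fixes c :: "nat \<Rightarrow> nat \<Rightarrow> real"
  assumes V: "finite V"
    and inj: "\<And>f w. (\<And>v. v \<in> V \<Longrightarrow> (\<Sum>u\<in>V. c v u * f u) = 0) \<Longrightarrow> w \<in> V \<Longrightarrow> f w = 0"
  shows "\<exists>f. \<forall>v\<in>V. (\<Sum>u\<in>V. c v u * f u) = s v"
proof -
  obtain m where m: "\<And>v. v \<in> V \<Longrightarrow> v < m"
    using V by (auto simp: finite_nat_set_iff_bounded)
  \<comment> \<open>Identity rows for the indices outside \<open>V\<close> make the system a square
    matrix without affecting injectivity.\<close>
  define A where "A = mat m m (\<lambda>(i, j). if i \<in> V \<and> j \<in> V then c i j else if i \<notin> V \<and> i = j then 1 else 0)"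
  have A: "A \<in> carrier_mat m m" by (simp add: A_def)
  have prod: "(A *\<^sub>v x) $ i = (if i \<in> V then (\<Sum>u\<in>V. c i u * x $ u) else x $ i)"
    if i: "i < m" and x: "x \<in> carrier_vec m" for i x
  proof -
    have "(A *\<^sub>v x) $ i = (\<Sum>j\<in>{0..<m}. A $$ (i, j) * x $ j)"
      using A i x by (simp add: scalar_prod_def)
    also have "\<dots> = (if i \<in> V then (\<Sum>u\<in>V. c i u * x $ u) else x $ i)"
    proof (cases "i \<in> V")
      case True
      have "(\<Sum>j\<in>{0..<m}. A $$ (i, j) * x $ j) = (\<Sum>j\<in>V. A $$ (i, j) * x $ j)"
        using m i True by (intro sum.mono_neutral_right) (auto simp: A_def)
      also have "\<dots> = (\<Sum>u\<in>V. c i u * x $ u)"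
        using m i True by (intro sum.cong) (auto simp: A_def)
      finally show ?thesis using True by simp
    next
      case False
      have "(\<Sum>j\<in>{0..<m}. A $$ (i, j) * x $ j) = (\<Sum>j\<in>{i}. A $$ (i, j) * x $ j)"
        using i False by (intro sum.mono_neutral_right) (auto simp: A_def)
      then show ?thesis using i False by (simp add: A_def)
    qed
    finally show ?thesis .
  qed
  have "det A \<noteq> 0"
  proof
    assume "det A = 0"
    then obtain x where x: "x \<in> carrier_vec m" "x \<noteq> 0\<^sub>v m" "A *\<^sub>v x = 0\<^sub>v m"
      using det_0_iff_vec_prod_zero[OF A] by blast
    have ker: "(if i \<in> V then (\<Sum>u\<in>V. c i u * x $ u) else x $ i) = 0" if "i < m" for i
      using prod[OF that x(1)] x(3) that by simp
    have "(\<Sum>u\<in>V. c v u * x $ u) = 0" if "v \<in> V" for v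
      using ker[OF m[OF that]] that by simp
    then have "x $ i = 0" if "i < m" for i
      using inj[of "\<lambda>i. x $ i" i] ker[OF that] by (cases "i \<in> V") auto
    then have "x = 0\<^sub>v m" using x(1) by (intro eq_vecI) auto
    with x(2) show False by simp
  qed
  from det_non_zero_imp_unit[OF A this, of "()"] obtain B
    where B: "B \<in> carrier_mat m m" "A * B = 1\<^sub>m m"
    by (auto simp: Units_def ring_mat_simps)
  define x where "x = B *\<^sub>v vec m s"
  have x: "x \<in> carrier_vec m" using B by (simp add: x_def)
  have "A *\<^sub>v x = vec m s"
    using A B by (simp add: x_def assoc_mult_mat_vec [symmetric])
  then have "(\<Sum>u\<in>V. c v u * x $ u) = s v" if "v \<in> V" for v
    using prod[OF m[OF that] x] m[OF that] that by simp
  then show ?thesis by blast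
qed

text \<open>The mean is the best centre, so every \<open>c\<close> is admissible. This removes the
  unspecified centre of a Poincare inequality as soon as the total of \<open>x\<close> is
  known.\<close>

lemma sum_square_le_mean:
  fixes x :: "'a \<Rightarrow> real"
  assumes "finite I" "I \<noteq> {}"
  shows "(\<Sum>i\<in>I. (x i)\<^sup>2) \<le> (\<Sum>i\<in>I. (x i - c)\<^sup>2) + (\<Sum>i\<in>I. x i)\<^sup>2 / card I"
proof -
  define N where "N = real (card I)"
  have N: "N > 0" using assms by (simp add: N_def card_gt_0_iff)
  define X where "X = (\<Sum>i\<in>I. x i)"
  have "(\<Sum>i\<in>I. (x i - c)\<^sup>2) = (\<Sum>i\<in>I. (x i)\<^sup>2) - 2 * c * X + N * c\<^sup>2"
    by (simp add: power2_diff sum.distrib sum_subtractf X_def N_def sum_distrib_left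
        sum_distrib_right mult_ac)
  moreover have "0 \<le> (N * c - X)\<^sup>2 / N" using N by simp
  moreover have "(N * c - X)\<^sup>2 / N = N * c\<^sup>2 - 2 * c * X + X\<^sup>2 / N"
    using N by (simp add: power2_diff diff_divide_distrib add_divide_distrib)
      (simp add: power2_eq_square mult_ac)
  ultimately show ?thesis unfolding X_def N_def by linarith
qed

context shuffle_heap
begin

text \<open>The Laplacian of the doubled graph on antisymmetric functions: with values
  \<open>f\<close> and \<open>- f\<close> on the two copies, the edge at a root contributes
  \<open>f - (- f) = 2 * f\<close>.\<close>

definition grounded :: "(nat \<Rightarrow> real) \<Rightarrow> nat \<Rightarrow> real" where
  "grounded f w = graph_lap heap_arcs f w + (if w \<in> roots then 2 * f w else 0)"

definition grounded_form :: "(nat \<Rightarrow> real) \<Rightarrow> (nat \<Rightarrow> real) \<Rightarrow> real" where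
  "grounded_form f g = dirichlet_form heap_arcs f g + 2 * (\<Sum>r\<in>roots. f r * g r)"

lemma grounded_form_commute: "grounded_form f g = grounded_form g f"
  by (simp add: grounded_form_def dirichlet_form_commute[of _ f] mult.commute)

lemma sum_grounded: "(\<Sum>w\<in>nodes. f w * grounded g w) = grounded_form f g"
proof -
  have "(\<Sum>w\<in>nodes. f w * grounded g w)
      = (\<Sum>w\<in>nodes. f w * graph_lap heap_arcs g w) + (\<Sum>w\<in>nodes. if w \<in> roots then 2 * (f w * g w) else 0)"
    by (simp add: grounded_def distrib_left sum.distrib [symmetric] if_distrib mult_ac cong: if_cong)
  also have "(\<Sum>w\<in>nodes. if w \<in> roots then 2 * (f w * g w) else 0) = (\<Sum>w\<in>roots. 2 * (f w * g w))"
    using roots_nodes by (simp add: sum.inter_restrict [symmetric] Int_absorb1)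
  finally show ?thesis
    using sum_graph_lap[OF finite_nodes heap_arcs_subset sym_heap_arcs]
    by (simp add: grounded_form_def sum_distrib_left)
qed

lemma energy_le_grounded_form:
  "(\<Sum>r\<in>roots. (f r)\<^sup>2) + dirichlet_form heap_arcs f f \<le> grounded_form f f"
proof -
  have "0 \<le> (\<Sum>r\<in>roots. (f r)\<^sup>2)" by (intro sum_nonneg) auto
  then show ?thesis by (simp add: grounded_form_def power2_eq_square)
qed

lemma nodes_square_le_grounded:
  "(\<Sum>w\<in>nodes. (f w)\<^sup>2) \<le> (real D + 1)\<^sup>2 * 2 ^ D * grounded_form f f"
  by (rule order_trans[OF nodes_square_le]) (intro mult_left_mono energy_le_grounded_form, simp)

lemma grounded_injective:
  assumes "\<And>v. v \<in> nodes \<Longrightarrow> grounded f v = 0" "w \<in> nodes"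
  shows "f w = 0"
proof -
  have "grounded_form f f = 0"
    unfolding sum_grounded [symmetric] using assms(1) by simp
  then have "(\<Sum>w\<in>nodes. (f w)\<^sup>2) \<le> 0" using nodes_square_le_grounded[of f] by simp
  then have "(\<Sum>w\<in>nodes. (f w)\<^sup>2) = 0" by (intro antisym sum_nonneg) auto
  then show ?thesis using assms(2) by (simp add: sum_nonneg_eq_0_iff)
qed

lemma green_exists:
  "\<exists>g. \<forall>w\<in>nodes. grounded g w = (if w = x then 1 else 0)"
proof -
  define c :: "nat \<Rightarrow> nat \<Rightarrow> real" where
    "c w v = (if v = w then real (card (heap_arcs `` {w})) else 0) - (if (w, v) \<in> heap_arcs then 1 else 0)
      + (if v = w \<and> w \<in> roots then 2 else 0)" for w v
  have ker: "grounded f w = (\<Sum>v\<in>nodes. c w v * f v)" if "w \<in> nodes" for f w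
  proof -
    have "heap_arcs `` {w} \<subseteq> nodes" using heap_arcs_subset by auto
    note graph_lap_eq_kernel[OF finite_nodes this that, of f]
    moreover have "(if w \<in> roots then 2 * f w else 0) = (\<Sum>v\<in>nodes. if v = w then (if w \<in> roots then 2 else 0) * f v else 0)"
      using that by (simp only: sum.delta[OF finite_nodes]) simp
    ultimately show ?thesis
      unfolding grounded_def c_def by (simp only: sum.distrib [symmetric]) (intro sum.cong, auto simp: algebra_simps)
  qed
  have "\<exists>g. \<forall>w\<in>nodes. (\<Sum>v\<in>nodes. c w v * g v) = (if w = x then 1 else 0)"
    by (rule injective_kernel_solvable) (auto intro: grounded_injective simp: ker [symmetric])
  then show ?thesis by (simp add: ker)
qed

text \<open>Only the values on \<open>nodes\<close> are determined by the equation; elsewhere they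
  depend on the choice.\<close>

definition green :: "nat \<Rightarrow> nat \<Rightarrow> real" where
  "green x = (SOME g. \<forall>w\<in>nodes. grounded g w = (if w = x then 1 else 0))"

lemma grounded_green: "w \<in> nodes \<Longrightarrow> grounded (green x) w = (if w = x then 1 else 0)"
  unfolding green_def using someI_ex[OF green_exists[of x]] by blast

text \<open>The reproducing property. It yields the symmetry of the Green function and identifies
  the energy of \<open>green x\<close> with its value at \<open>x\<close>.\<close>

lemma grounded_form_green: "x \<in> nodes \<Longrightarrow> grounded_form f (green x) = f x"
proof -
  assume x: "x \<in> nodes"
  have "grounded_form f (green x) = (\<Sum>w\<in>nodes. if w = x then f w else 0)"
    unfolding sum_grounded [symmetric] by (intro sum.cong) (auto simp: grounded_green)
  then show ?thesis using x by simp
qed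

lemma green_commute: "x \<in> nodes \<Longrightarrow> y \<in> nodes \<Longrightarrow> green x y = green y x"
  using grounded_form_green[of x "green y"] grounded_form_green[of y "green x"]
    grounded_form_commute[of "green x" "green y"] by simp

lemma leaf_nodes: "level D \<subseteq> nodes"
  by (auto simp: level_def nodes_def mult_2[of D] intro: order_trans[of "2 ^ D" "2 ^ (D + D)"])

lemma card_leaves: "card (level D) = 4 ^ D"
  by (simp add: level_def power_mult mult_2[of D] power_add power_mult_distrib [symmetric])

text \<open>Duality: pairing \<open>green w\<close> with the response to a unit demand at every leaf
  can be evaluated from either side.\<close>

lemma sum_green_leaves:
  assumes "w \<in> nodes"
  shows "(\<Sum>x\<in>level D. green w x) = mean_potential w"
proof -
  have "grounded_form (green w) mean_potential = mean_potential w"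
    using grounded_form_green[OF assms] by (simp only: grounded_form_commute[of "green w"])
  then show ?thesis
    using mean_potential_weak[of "green w"] by (simp only: grounded_form_def sum_level_D)
qed

text \<open>
  The source \<open>w\<close> sends its unit of current up the tree, which bounds the energy of the potential by
  the path length; the shuffle edges then make the potential nearly constant on the leaves.
\<close>

lemma sum_green_square_le:
  assumes w: "w \<in> nodes" and D2: "2 \<le> D"
  shows "(\<Sum>x\<in>level D. (green w x)\<^sup>2) \<le> (4 * (real D)\<^sup>2)\<^sup>2"
proof -
  let ?a = "green w"
  have form: "grounded_form ?a ?a = ?a w" using w by (rule grounded_form_green)
  have E: "dirichlet_form heap_arcs ?a ?a \<le> ?a w"
    using energy_le_grounded_form[of ?a] sum_nonneg[of roots "\<lambda>r. (?a r)\<^sup>2"] form by simp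
  \<comment> \<open>Since the energy of \<open>?a\<close> equals \<open>?a w\<close>, the path bound
    on its square is a linear bound on \<open>?a w\<close> itself.\<close>
  have "(?a w)\<^sup>2 \<le> (real D + 1) * grounded_form ?a ?a"
    by (rule order_trans[OF node_square_le[OF w]]) (intro mult_left_mono energy_le_grounded_form, simp)
  then have "?a w * ?a w \<le> (real D + 1) * ?a w"
    by (simp only: form power2_eq_square)
  moreover have "?a w \<ge> 0" using E dirichlet_form_nonneg[of heap_arcs ?a] by linarith
  ultimately have aw: "?a w \<le> real D + 1"
    by (cases "?a w = 0") (simp_all add: mult_le_cancel_right)
  obtain c where c: "(\<Sum>x\<in>level D. (?a x - c)\<^sup>2) \<le> 16 * (real D)\<^sup>2 * dirichlet_form heap_arcs ?a ?a"
    using leaf_poincare[of ?a] by (auto simp: sum_level_D)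
  have "level D \<noteq> {}" "finite (level D)"
    by (auto simp: level_def)
  then have "(\<Sum>x\<in>level D. (?a x)\<^sup>2)
      \<le> (\<Sum>x\<in>level D. (?a x - c)\<^sup>2) + (\<Sum>x\<in>level D. ?a x)\<^sup>2 / card (level D)"
    by (intro sum_square_le_mean)
  also have "(\<Sum>x\<in>level D. (?a x - c)\<^sup>2) \<le> 16 * (real D)\<^sup>2 * (real D + 1)"
    using c E aw by (smt (verit) mult_left_mono zero_le_power2)
  also have "(\<Sum>x\<in>level D. ?a x)\<^sup>2 / card (level D) \<le> 9 / 4"
  proof -
    have "(mean_potential w)\<^sup>2 \<le> (3 / 2 * 2 ^ D)\<^sup>2"
      using mean_potential_bounds[OF w] by (intro power_mono)
    also have "(3 / 2 * 2 ^ D)\<^sup>2 = 9 / 4 * (4::real) ^ D"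
      by (simp add: power_mult_distrib power2_eq_square power_divide flip: power_mult_distrib)
    finally show ?thesis
      using w by (simp add: sum_green_leaves card_leaves divide_le_eq)
  qed
  also have "16 * (real D)\<^sup>2 * (real D + 1) + 9 / 4 \<le> (4 * (real D)\<^sup>2)\<^sup>2"
  proof -
    define t where "t = real D"
    have t: "t \<ge> 2" using D2 by (simp add: t_def)
    have "2 * t \<le> t * t" "4 \<le> t * t" using t mult_mono[of 2 t 2 t] by auto
    then have "1 \<le> t * t - t - 1" using t by linarith
    then have "16 * (t * t) * 1 \<le> 16 * (t * t) * (t * t - t - 1)"
      by (intro mult_left_mono) auto
    then show ?thesis using \<open>4 \<le> t * t\<close>
      unfolding t_def [symmetric] by (simp add: power2_eq_square algebra_simps)
  qed
  finally show ?thesis by simp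
qed

section \<open>Concentration of the random potential\<close>

definition potential :: "nat set \<Rightarrow> nat \<Rightarrow> real" where
  "potential S w = (\<Sum>x\<in>level D. coin_sign S x * green x w)"

lemma grounded_potential:
  assumes "w \<in> nodes"
  shows "grounded (potential S) w = (if w \<in> level D then coin_sign S w else 0)"
proof -
  have "graph_lap heap_arcs (potential S) w = (\<Sum>x\<in>level D. coin_sign S x * graph_lap heap_arcs (green x) w)"
    unfolding graph_lap_def potential_def sum_subtractf [symmetric] sum_distrib_left
    by (subst sum.swap) (simp add: right_diff_distrib)
  moreover have "(if w \<in> roots then 2 * potential S w else 0)
      = (\<Sum>x\<in>level D. coin_sign S x * (if w \<in> roots then 2 * green x w else 0))"
    by (simp add: potential_def sum_distrib_left mult_ac)
  ultimately have "grounded (potential S) w = (\<Sum>x\<in>level D. coin_sign S x * grounded (green x) w)"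
    by (simp only: grounded_def sum.distrib distrib_left)
  also have "\<dots> = (\<Sum>x\<in>level D. if w = x then coin_sign S x else 0)"
    using assms by (intro sum.cong) (auto simp: grounded_green)
  finally show ?thesis by (simp add: level_def)
qed

lemma potential_compl: "potential (level D - S) w = - potential S w"
proof -
  have "coin_sign (level D - S) x = - coin_sign S x" if "x \<in> level D" for x
    using that by (simp add: coin_sign_def)
  then show ?thesis by (simp add: potential_def sum_negf [symmetric])
qed

text \<open>The threshold is \<open>5 * D\<close> times the row norm bound \<open>4 * D^2\<close>;
  the factor \<open>5 * D\<close> pays for a union bound over fewer than \<open>2 * 4 ^ D\<close>
  nodes. All nodes have to be controlled, because the permitted error scales with the maximum norm
  of the solution.\<close>

definition near_mean :: "real \<Rightarrow> nat set set" where
  "near_mean \<delta> = {S. S \<subseteq> level D \<and>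
    (\<forall>w\<in>nodes. \<bar>potential S w - \<delta> * mean_potential w\<bar> < 20 * real D ^ 3)}"

lemma near_mean_weight:
  assumes D2: "2 \<le> D" and \<delta>: "\<bar>\<delta>\<bar> \<le> 1"
  shows "(\<Sum>S\<in>near_mean \<delta>. coin_weight \<delta> (level D) S) \<ge> 7 / 8"
proof -
  let ?X = "level D" and ?\<tau> = "20 * real D ^ 3" and ?P = "4 * (real D)\<^sup>2"
  have finX: "finite ?X" by (simp add: level_def)
  define W where "W = coin_weight \<delta> ?X"
  have W0: "W S \<ge> 0" for S unfolding W_def by (rule coin_weight_nonneg[OF \<delta>])
  define T where "T w = {S. S \<subseteq> ?X \<and> ?\<tau> \<le> \<bar>\<Sum>x\<in>?X. green w x * (coin_sign S x - \<delta>)\<bar>}" for w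
  have finT: "finite (T w)" for w
    unfolding T_def by (rule finite_subset[of _ "Pow ?X"]) (use finX in auto)
  have dev: "potential S w - \<delta> * mean_potential w = (\<Sum>x\<in>?X. green w x * (coin_sign S x - \<delta>))"
    if w: "w \<in> nodes" for S w
  proof -
    have "potential S w = (\<Sum>x\<in>?X. coin_sign S x * green w x)"
      unfolding potential_def using leaf_nodes w by (intro sum.cong) (auto simp: green_commute)
    then show ?thesis
      unfolding sum_green_leaves[OF w, symmetric]
      by (simp add: sum_distrib_left sum_subtractf right_diff_distrib mult.commute)
  qed
  have tail: "(\<Sum>S\<in>T w. W S) \<le> 2 * exp (1 - 5 * real D)" if w: "w \<in> nodes" for w
  proof -
    have "?\<tau> / ?P = 5 * real D"
      using D2 by (simp add: power2_eq_square power3_eq_cube)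
    moreover have "?P > 0" using D2 by simp
    ultimately show ?thesis
      using coin_tail_abs[OF finX \<delta> _ sum_green_square_le[OF w D2], of ?\<tau>]
      by (simp add: T_def W_def)
  qed
  have good: "near_mean \<delta> \<subseteq> Pow ?X" by (auto simp: near_mean_def)
  have "Pow ?X - near_mean \<delta> \<subseteq> (\<Union>w\<in>nodes. T w)"
    by (auto simp: near_mean_def T_def not_less dev)
  then have "(\<Sum>S\<in>Pow ?X - near_mean \<delta>. W S) \<le> (\<Sum>S\<in>(\<Union>w\<in>nodes. T w). W S)"
    using finT W0 by (intro sum_mono2) auto
  also have "\<dots> \<le> (\<Sum>w\<in>nodes. \<Sum>S\<in>T w. W S)"
  proof -
    have "(\<Sum>S\<in>(\<Union>w\<in>I. T w). W S) \<le> (\<Sum>w\<in>I. \<Sum>S\<in>T w. W S)" if "finite I" for I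
      using that
    proof induction
      case (insert i I)
      have "(\<Sum>S\<in>T i \<union> (\<Union>w\<in>I. T w). W S) \<le> (\<Sum>S\<in>T i. W S) + (\<Sum>S\<in>(\<Union>w\<in>I. T w). W S)"
        using finT insert.hyps(1) sum_nonneg[of "T i \<inter> (\<Union>w\<in>I. T w)" W] W0 by (simp add: sum_Un)
      with insert show ?case by simp
    qed simp
    then show ?thesis by simp
  qed
  also have "\<dots> \<le> (\<Sum>w\<in>nodes. 2 * exp (1 - 5 * real D))"
    by (intro sum_mono tail)
  also have "\<dots> \<le> 2 * 4 ^ D * (2 * exp (1 - 5 * real D))"
  proof -
    have "card nodes \<le> 2 * 4 ^ D"
      by (simp add: nodes_def power_mult)
    then have "real (card nodes) \<le> real (2 * 4 ^ D)" by (rule of_nat_mono)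
    then show ?thesis by (simp add: mult_right_mono)
  qed
  also have "\<dots> \<le> 1 / 8"
  proof -
    \<comment> \<open>The claim amounts to \<open>32 * 4 ^ D \<le> exp (5 * D - 1)\<close>; with
      \<open>2 \<le> exp 1\<close> it reduces to \<open>2 * D + 5 \<le> 5 * D - 1\<close>, that is
      \<open>2 \<le> D\<close>.\<close>
    have "(2::real) ^ (2 * D + 5) \<le> 2 ^ (5 * D - 1)"
      using D2 by (intro power_increasing) auto
    also have "\<dots> \<le> exp 1 ^ (5 * D - 1)"
      using exp_ge_add_one_self[of 1] by (intro power_mono) auto
    also have "\<dots> = exp (5 * real D - 1)"
      using D2 by (simp add: exp_of_nat_mult [symmetric] of_nat_diff)
    finally have "32 * 4 ^ D \<le> exp (5 * real D - 1)"
      by (simp add: power_add power_mult)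
    then have "32 * 4 ^ D * exp (1 - 5 * real D) \<le> exp (5 * real D - 1) * exp (1 - 5 * real D)"
      by (intro mult_right_mono) auto
    also have "\<dots> = 1" by (simp add: exp_add [symmetric])
    finally show ?thesis by simp
  qed
  finally have "(\<Sum>S\<in>Pow ?X - near_mean \<delta>. W S) \<le> 1 / 8" .
  moreover have "(\<Sum>S\<in>Pow ?X. W S) = (\<Sum>S\<in>Pow ?X - near_mean \<delta>. W S) + (\<Sum>S\<in>near_mean \<delta>. W S)"
    using good finX by (intro sum.subset_diff) auto
  ultimately show ?thesis
    using sum_coin_weight[OF finX, of \<delta>] unfolding W_def by linarith
qed

end

section \<open>Doubling the heap\<close>

text \<open>An entry beyond the dimension is unspecified but independent of the function, so probing
  outside the vector reveals nothing.\<close>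

lemma vec_index_vec_cong: "(i < n \<Longrightarrow> f i = g i) \<Longrightarrow> vec n f $ i = vec n g $ i"
  by transfer (simp add: mk_vec_def)

text \<open>Complementing \<open>S\<close> negates the potential, so an accurate answer reveals the sign of the bias.\<close>

lemma antisymmetric_probe_lower_bound:
  fixes L :: "real mat" and f :: "'a set \<Rightarrow> nat \<Rightarrow> real" and \<pi> :: "nat \<Rightarrow> 'a"
  assumes R: "prob_space R" "solves_difference L u v \<epsilon> R" "worst_case_probes_le L R q"
    and L: "L \<in> carrier_mat n n" and uv: "u < n" "v < n"
    and fin: "finite X" and \<delta>: "0 \<le> \<delta>" "\<delta> \<le> 1"
    and good: "good \<subseteq> Pow X" "(\<Sum>S\<in>good. coin_weight \<delta> X S) \<ge> 7 / 8"
    and Lf: "\<And>S. L *\<^sub>v vec n (f S) = vec n (g S)"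
    and dep: "\<And>i S S'. (\<pi> i \<in> S \<longleftrightarrow> \<pi> i \<in> S') \<Longrightarrow> g S i = g S' i"
    and compl: "\<And>S i. f (X - S) i = - f S i"
    and gap: "\<And>S. S \<in> good \<Longrightarrow> \<epsilon> * linf_norm (vec n (f S)) < f S u - f S v"
  shows "1 / 36 \<le> real q * \<delta>\<^sup>2"
proof -
  define b where "b S = vec n (g S)" for S
  define ok where "ok S A \<longleftrightarrow>
    \<bar>answer A (b S) - (vec n (f S) $ u - vec n (f S) $ v)\<bar> \<le> \<epsilon> * linf_norm (vec n (f S))" for S A
  have linf: "linf_norm (vec n (f (X - S))) = linf_norm (vec n (f S))" for S
    unfolding linf_norm_def by (intro arg_cong[where f = Max] image_cong) (auto simp: compl)
  have range: "b S \<in> mat_range L" for S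
    unfolding mat_range_def b_def using L by (intro image_eqI[of _ _ "vec n (f S)"]) (auto simp: Lf)
  have prob: "measure R {A \<in> space R. ok S A} \<ge> 2 / 3" for S
  proof -
    have "vec n (f S) \<in> carrier_vec (dim_col L)" "L *\<^sub>v vec n (f S) = b S"
      using L by (simp_all add: b_def Lf)
    from R(2)[unfolded solves_difference_def, rule_format, OF range[of S] this] show ?thesis
      unfolding ok_def .
  qed
  show ?thesis
  proof (rule biased_coin_probe_lower_bound[OF R(1) fin \<delta> _ _ good])
    show "b S $ i = b S' $ i" if "\<pi> i \<in> S \<longleftrightarrow> \<pi> i \<in> S'" for i S S'
      unfolding b_def using dep[OF that] by (intro vec_index_vec_cong)
    show "AE A in R. card (probed A (b S)) \<le> q" for S
      using R(3) range[of S] by (simp add: worst_case_probes_le_def)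
    show "measure R {A \<in> space R. ok S A} \<ge> 2 / 3" "measure R {A \<in> space R. ok (X - S) A} \<ge> 2 / 3"
      for S by (rule prob)+
    show "answer A (b S) > 0" if "S \<in> good" "ok S A" for S A
      using that(2) gap[OF that(1)] uv by (simp add: ok_def abs_le_iff)
    show "answer A (b (X - S)) < 0" if "S \<in> good" "ok (X - S) A" for S A
      using that(2) gap[OF that(1)] uv by (simp add: ok_def linf compl abs_le_iff)
  qed
qed

text \<open>The copies of \<open>w\<close> are numbered \<open>2 * w\<close> and
  \<open>2 * w + 1\<close>, so parity names the copy; \<open>M\<close> is the set of vertices whose
  two copies are joined.\<close>

definition double_arcs :: "(nat \<times> nat) set \<Rightarrow> nat set \<Rightarrow> (nat \<times> nat) set" where
  "double_arcs E M = {(a, b). (a mod 2 = b mod 2 \<and> (a div 2, b div 2) \<in> E)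
    \<or> (a div 2 = b div 2 \<and> a div 2 \<in> M \<and> a \<noteq> b)}"

lemma double_arcs_nbrs:
  "double_arcs E M `` {2 * w} = (\<lambda>v. 2 * v) ` (E `` {w}) \<union> (if w \<in> M then {2 * w + 1} else {})" (is ?even)
  "double_arcs E M `` {2 * w + 1} = (\<lambda>v. 2 * v + 1) ` (E `` {w}) \<union> (if w \<in> M then {2 * w} else {})" (is ?odd)
proof -
  have parity: "2 * x \<noteq> Suc (2 * y)" "Suc (2 * y) \<noteq> 2 * x" for x y :: nat
    by presburger+
  have "b \<in> double_arcs E M `` {2 * w} \<longleftrightarrow> b \<in> (\<lambda>v. 2 * v) ` (E `` {w}) \<union> (if w \<in> M then {2 * w + 1} else {})" for b
  proof (cases "even b")
    case True
    then obtain v where "b = 2 * v" by blast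
    then show ?thesis by (auto simp: double_arcs_def parity)
  next
    case False
    then obtain v where "b = 2 * v + 1" by (blast elim: oddE)
    then show ?thesis by (auto simp: double_arcs_def parity)
  qed
  then show ?even by blast
  have "b \<in> double_arcs E M `` {2 * w + 1} \<longleftrightarrow> b \<in> (\<lambda>v. 2 * v + 1) ` (E `` {w}) \<union> (if w \<in> M then {2 * w} else {})" for b
  proof (cases "even b")
    case True
    then obtain v where "b = 2 * v" by blast
    then show ?thesis by (auto simp: double_arcs_def parity)
  next
    case False
    then obtain v where "b = 2 * v + 1" by (blast elim: oddE)
    then show ?thesis by (auto simp: double_arcs_def parity)
  qed
  then show ?odd by blast
qed

lemma graph_lap_double:
  assumes "finite (E `` {w})"
  shows "graph_lap (double_arcs E M) x (2 * w)
      = graph_lap E (\<lambda>v. x (2 * v)) w + (if w \<in> M then x (2 * w) - x (2 * w + 1) else 0)"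
    and "graph_lap (double_arcs E M) x (2 * w + 1)
      = graph_lap E (\<lambda>v. x (2 * v + 1)) w + (if w \<in> M then x (2 * w + 1) - x (2 * w) else 0)"
proof -
  have "(\<lambda>v. 2 * v) ` A \<inter> {2 * w + 1} = {}" "(\<lambda>v. 2 * v + 1) ` A \<inter> {2 * w} = {}" for A :: "nat set"
    by (auto, presburger+)
  then show "graph_lap (double_arcs E M) x (2 * w)
      = graph_lap E (\<lambda>v. x (2 * v)) w + (if w \<in> M then x (2 * w) - x (2 * w + 1) else 0)"
    and "graph_lap (double_arcs E M) x (2 * w + 1)
      = graph_lap E (\<lambda>v. x (2 * v + 1)) w + (if w \<in> M then x (2 * w + 1) - x (2 * w) else 0)"
    using assms unfolding graph_lap_def double_arcs_nbrs
    by (auto simp: sum.union_disjoint sum.reindex inj_on_def)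
qed

context shuffle_heap
begin

text \<open>A leaf has its parent, its rotation, and at most the two candidates for its preimage
  under rotation: \<open>z div 2\<close> without or with the top bit.\<close>

lemma heap_nbrs:
  "w < leaves \<Longrightarrow> heap_arcs `` {w} \<subseteq> {w div 2, 2 * w, 2 * w + 1}"
  "heap_arcs `` {leaves + z} \<subseteq> {(leaves + z) div 2, leaves + shuffle z, leaves + z div 2, leaves + (z div 2 + half)}"
proof -
  have tree: "v = w div 2 \<or> v = 2 * w \<or> v = 2 * w + 1" if "(w, v) \<in> tree_arcs \<union> tree_arcs\<inverse>" for v w
    using that by (auto simp: tree_arcs_def)
  then show "w < leaves \<Longrightarrow> heap_arcs `` {w} \<subseteq> {w div 2, 2 * w, 2 * w + 1}"
    using shuffle_arc_ge by (force simp: heap_arcs_def)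
  have down: "(v, leaves + z) \<notin> tree_arcs" for v
    using tree_arc_less(1)[of v "leaves + z"] by auto
  have up: "v = (leaves + z) div 2" if "(leaves + z, v) \<in> tree_arcs" for v
    using that by (auto simp: tree_arcs_def)
  have inv: "y = z div 2 \<or> y = z div 2 + half" if "y < leaves" "shuffle y = z" for y
  proof -
    have lt: "y div half < 2" using that(1) leaves_half by (simp add: less_mult_imp_div_less)
    then have "z div 2 = y mod half" using that(2) by (auto simp: shuffle_def)
    moreover have "y = half * (y div half) + y mod half" by simp
    moreover have "y div half = 0 \<or> y div half = 1" using lt by linarith
    ultimately show ?thesis by (metis add.commute add_0 mult.right_neutral mult_0_right)
  qed
  have "v \<in> {leaves + shuffle z, leaves + z div 2, leaves + (z div 2 + half)}"
    if "(leaves + z, v) \<in> leaf_arcs" for v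
    using that inv by (fastforce simp: leaf_arcs_def shuffle_arcs_def)
  then show "heap_arcs `` {leaves + z} \<subseteq> {(leaves + z) div 2, leaves + shuffle z, leaves + z div 2, leaves + (z div 2 + half)}"
    using up down unfolding heap_arcs_def by blast
qed

lemma finite_heap_nbrs: "finite (heap_arcs `` {w})"
  by (rule finite_Image) simp

text \<open>The summand reserves room for the edge between the two copies of a root. Above the
  leaves 3 neighbours is the maximum, and no root is a leaf.\<close>

lemma card_heap_nbrs: "card (heap_arcs `` {w}) + (if w \<in> roots then 1 else 0) \<le> 4"
proof (cases "w < leaves")
  case True
  have "card (heap_arcs `` {w}) \<le> card {w div 2, 2 * w, 2 * w + 1}"
    using heap_nbrs(1)[OF True] by (intro card_mono) auto
  also have "\<dots> \<le> 3" by (simp add: card_insert_if)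
  finally show ?thesis by simp
next
  case False
  then obtain z where z: "w = leaves + z" by (metis add.commute le_Suc_ex not_less)
  have "card (heap_arcs `` {w}) \<le> card {(leaves + z) div 2, leaves + shuffle z, leaves + z div 2, leaves + (z div 2 + half)}"
    using heap_nbrs(2)[of z] unfolding z by (intro card_mono) auto
  also have "\<dots> \<le> 4" by (simp add: card_insert_if)
  finally have "card (heap_arcs `` {w}) \<le> 4" .
  moreover have "(2::nat) ^ (D + 1) \<le> leaves" using D by (intro power_increasing) auto
  then have "w \<notin> roots" using False by (auto simp: roots_def)
  ultimately show ?thesis by simp
qed

abbreviation "F \<equiv> double_arcs heap_arcs roots"

text \<open>The codes must avoid the vertices 0 to 4 of the star; for \<open>D = 1\<close> the first
  code would be 4.\<close>

lemma node_code_range: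
  assumes D2: "2 \<le> D" and w: "a div 2 \<in> nodes"
  shows "8 \<le> a" "a < 4 * 4 ^ D"
proof -
  have "(2::nat) ^ 2 \<le> 2 ^ D" using D2 by (rule power_increasing) simp
  then have "4 \<le> a div 2" using w by (auto simp: nodes_def)
  then show "8 \<le> a" by linarith
  have "a div 2 < 2 * 4 ^ D" using w by (simp add: nodes_def power_mult)
  then show "a < 4 * 4 ^ D" by linarith
qed

lemma far_arcs_double:
  assumes D2: "2 \<le> D" and n: "4 * 4 ^ D \<le> n"
  shows "far_arcs n F"
proof
  have "(4::nat) ^ 1 \<le> 4 ^ D" using D by (intro power_increasing) auto
  then show "5 \<le> n" using n by simp
  have "a div 2 \<in> nodes" "b div 2 \<in> nodes" if "(a, b) \<in> F" for a b
    using that heap_arcs_subset roots_nodes by (auto simp: double_arcs_def)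
  then show "F \<subseteq> {5..<n} \<times> {5..<n}"
    using node_code_range[OF D2] n by fastforce
  show "sym F" using sym_heap_arcs by (auto simp: sym_def double_arcs_def)
  show "irrefl F" using irrefl_heap_arcs by (auto simp: irrefl_def double_arcs_def)
  show "card (F `` {a}) \<le> 4" for a
  proof (cases "even a")
    case True
    then obtain w where w: "a = 2 * w" by blast
    have "card (F `` {a}) \<le> card ((\<lambda>v. 2 * v) ` (heap_arcs `` {w})) + card (if w \<in> roots then {2 * w + 1} else {})"
      unfolding w double_arcs_nbrs by (rule card_Un_le)
    also have "\<dots> \<le> card (heap_arcs `` {w}) + (if w \<in> roots then 1 else 0)"
      using card_image_le[OF finite_heap_nbrs] by (auto intro: add_mono)
    finally show ?thesis using card_heap_nbrs[of w] by linarith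
  next
    case False
    then obtain w where w: "a = 2 * w + 1" by (blast elim: oddE)
    have "card (F `` {a}) \<le> card ((\<lambda>v. 2 * v + 1) ` (heap_arcs `` {w})) + card (if w \<in> roots then {2 * w} else {})"
      unfolding w double_arcs_nbrs by (rule card_Un_le)
    also have "\<dots> \<le> card (heap_arcs `` {w}) + (if w \<in> roots then 1 else 0)"
      using card_image_le[OF finite_heap_nbrs] by (auto intro: add_mono)
    finally show ?thesis using card_heap_nbrs[of w] by linarith
  qed
qed

section \<open>Spectral gap of the doubled graph\<close>

lemma graph_lap_heap_outside: "w \<notin> nodes \<Longrightarrow> graph_lap heap_arcs f w = 0"
proof -
  assume "w \<notin> nodes"
  then have "heap_arcs `` {w} = {}" using heap_arcs_subset by auto
  then show ?thesis by (simp add: graph_lap_def)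
qed

text \<open>A Laplacian sums to zero over the nodes, so a non-zero eigenvalue forces mean zero, and
  then the Poincare inequality holds with centre 0.\<close>

lemma spectral_gap_mean_zero:
  assumes ev: "\<And>w. w \<in> nodes \<Longrightarrow> graph_lap heap_arcs p w = l * p w"
    and l: "l \<noteq> 0" and ne: "v \<in> nodes" "p v \<noteq> 0"
  shows "1 \<le> (real D + 1) * (16 * (real D)\<^sup>2 + 1) * l"
proof -
  define Q where "Q = (\<Sum>w\<in>nodes. (p w)\<^sup>2)"
  have "0 < (p v)\<^sup>2" using ne(2) by simp
  also have "\<dots> \<le> Q" unfolding Q_def using ne(1) by (intro member_le_sum) auto
  finally have Q: "0 < Q" .
  have "l * (\<Sum>w\<in>nodes. p w) = (\<Sum>w\<in>nodes. 1 * graph_lap heap_arcs p w)"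
    by (simp add: ev sum_distrib_left)
  also have "\<dots> = 0"
    by (subst sum_graph_lap[OF finite_nodes heap_arcs_subset sym_heap_arcs]) (simp add: dirichlet_form_def)
  finally have mean: "(\<Sum>w\<in>nodes. p w) = 0" using l by simp
  have E: "dirichlet_form heap_arcs p p = l * Q"
    unfolding sum_graph_lap[OF finite_nodes heap_arcs_subset sym_heap_arcs, symmetric] Q_def sum_distrib_left
    by (intro sum.cong) (auto simp: ev power2_eq_square)
  obtain c where "(\<Sum>w\<in>nodes. (p w - c)\<^sup>2) \<le> (real D + 1) * (16 * (real D)\<^sup>2 + 1) * (l * Q)"
    using nodes_poincare[of p] unfolding E by blast
  moreover have "Q \<le> (\<Sum>w\<in>nodes. (p w - c)\<^sup>2)"
    using sum_square_le_mean[of nodes p c] ne(1) mean by (auto simp: Q_def)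
  ultimately have "1 * Q \<le> ((real D + 1) * (16 * (real D)\<^sup>2 + 1) * l) * Q" by simp
  then show ?thesis using Q by (rule mult_right_le_imp_le)
qed

lemma spectral_gap_grounded:
  assumes ev: "\<And>w. w \<in> nodes \<Longrightarrow> grounded p w = l * p w"
    and ne: "v \<in> nodes" "p v \<noteq> 0"
  shows "1 \<le> (real D + 1)\<^sup>2 * 2 ^ D * l"
proof -
  define Q where "Q = (\<Sum>w\<in>nodes. (p w)\<^sup>2)"
  have "0 < (p v)\<^sup>2" using ne(2) by simp
  also have "\<dots> \<le> Q" unfolding Q_def using ne(1) by (intro member_le_sum) auto
  finally have Q: "0 < Q" .
  have "grounded_form p p = l * Q"
    unfolding sum_grounded [symmetric] Q_def sum_distrib_left
    by (intro sum.cong) (auto simp: ev power2_eq_square)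
  then have "1 * Q \<le> ((real D + 1)\<^sup>2 * 2 ^ D * l) * Q"
    using nodes_square_le_grounded[of p] by (simp add: Q_def)
  then show ?thesis using Q by (rule mult_right_le_imp_le)
qed

text \<open>The grounded gap dictates the order \<open>(D + 1)^2 * 2 ^ D\<close>; the factor 16 lets
  it also dominate the polynomial constant of the symmetric part.\<close>

definition gap_const :: real where "gap_const = 16 * ((real D + 1)\<^sup>2 * 2 ^ D)"

lemma gap_const_ge:
  "1 \<le> gap_const" "(real D + 1) * (16 * (real D)\<^sup>2 + 1) \<le> gap_const" "(real D + 1)\<^sup>2 * 2 ^ D \<le> gap_const"
proof -
  have pow: "real D + 1 \<le> 2 ^ D"
    by (metis Suc_leI add.commute less_exp of_nat_Suc of_nat_le_iff of_nat_numeral of_nat_power)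
  have "1 * 1 \<le> (real D + 1)\<^sup>2 * 2 ^ D"
    by (intro mult_mono) (auto simp: one_le_power)
  then show "1 \<le> gap_const" "(real D + 1)\<^sup>2 * 2 ^ D \<le> gap_const" by (auto simp: gap_const_def)
  have "16 * (real D)\<^sup>2 + 1 \<le> 16 * (real D + 1)\<^sup>2" by (simp add: power2_eq_square algebra_simps)
  also have "\<dots> \<le> 16 * ((real D + 1) * 2 ^ D)"
    using pow by (simp add: power2_eq_square mult_left_mono)
  finally have "(real D + 1) * (16 * (real D)\<^sup>2 + 1) \<le> (real D + 1) * (16 * ((real D + 1) * 2 ^ D))"
    by (intro mult_left_mono) auto
  then show "(real D + 1) * (16 * (real D)\<^sup>2 + 1) \<le> gap_const"
    by (simp add: gap_const_def power2_eq_square mult_ac)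
qed

text \<open>
  Eigenvectors split along the symmetry exchanging the two copies: the symmetric part is an
  eigenvector of the Laplacian of the heap, the antisymmetric part one of the grounded operator.
\<close>

lemma spectral_gap_double:
  assumes D2: "2 \<le> D" and n: "4 * 4 ^ D \<le> n" and l: "l \<noteq> 0"
    and ev: "\<And>a. a \<in> {5..<n} \<Longrightarrow> graph_lap F f a = l * f a"
    and ne: "\<exists>a\<in>{5..<n}. f a \<noteq> 0"
  shows "1 / gap_const \<le> l"
proof -
  define p where "p w = f (2 * w) + f (2 * w + 1)" for w
  define m where "m w = f (2 * w) - f (2 * w + 1)" for w
  have code: "2 * w \<in> {5..<n}" "2 * w + 1 \<in> {5..<n}" if "w \<in> nodes" for w
    using node_code_range[OF D2, of "2 * w"] node_code_range[OF D2, of "2 * w + 1"] that n by auto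
  have evp: "graph_lap heap_arcs p w = l * p w" and evm: "grounded m w = l * m w" if "w \<in> nodes" for w
  proof -
    note e = ev[OF code(1)[OF that]] ev[OF code(2)[OF that]]
    note e' = e[unfolded graph_lap_double[OF finite_heap_nbrs]]
    have "graph_lap heap_arcs p w = graph_lap heap_arcs (\<lambda>v. f (2 * v)) w + graph_lap heap_arcs (\<lambda>v. f (2 * v + 1)) w"
      by (simp add: graph_lap_def p_def sum.distrib [symmetric] algebra_simps)
    also have "\<dots> = l * p w"
      using e' by (simp add: p_def distrib_left split: if_splits)
    finally show "graph_lap heap_arcs p w = l * p w" .
    have "graph_lap heap_arcs m w = graph_lap heap_arcs (\<lambda>v. f (2 * v)) w - graph_lap heap_arcs (\<lambda>v. f (2 * v + 1)) w"
      by (simp add: graph_lap_def m_def sum_subtractf [symmetric] algebra_simps)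
    then show "grounded m w = l * m w"
      using e' by (simp add: grounded_def m_def right_diff_distrib split: if_splits)
  qed
  have "\<exists>w\<in>nodes. p w \<noteq> 0 \<or> m w \<noteq> 0"
  proof (rule ccontr)
    assume none: "\<not> ?thesis"
    have zero: "f (2 * w) = 0" "f (2 * w + 1) = 0" if "w \<in> nodes" for w
      using none that by (auto simp: p_def m_def)
    have "f a = 0" if a: "a \<in> {5..<n}" for a
    proof (cases "a div 2 \<in> nodes")
      case True
      then show ?thesis using zero[OF True] by (cases "even a") auto
    next
      \<comment> \<open>Off the two copies the operator is 0, so an eigenvector with
        \<open>l \<noteq> 0\<close> vanishes there, in particular at isolated vertices.\<close>
      case False
      then have "a div 2 \<notin> roots" using roots_nodes by auto
      then have "graph_lap F f a = 0"
        using graph_lap_double[OF finite_heap_nbrs, of roots f "a div 2"] graph_lap_heap_outside[OF False]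
        by (cases "even a") auto
      then show ?thesis using ev[OF a] l by simp
    qed
    with ne show False by blast
  qed
  then have "\<exists>K. K \<le> gap_const \<and> 1 \<le> K * l \<and> 0 \<le> K"
    using spectral_gap_mean_zero[OF evp l] spectral_gap_grounded[OF evm] gap_const_ge
    by (metis (no_types, lifting) add_nonneg_nonneg mult_nonneg_nonneg of_nat_0_le_iff zero_le_numeral
        zero_le_one zero_le_power zero_le_power2)
  then obtain K where K: "K \<le> gap_const" "1 \<le> K * l" "0 \<le> K" by blast
  \<comment> \<open>The sign of \<open>l\<close> has to be known before \<open>K\<close> is replaced
    by the larger constant.\<close>
  then have "0 \<le> l" by (metis less_le_not_le mult_nonneg_nonpos not_one_le_zero order_trans linear)
  then have "K * l \<le> gap_const * l" using K(1) by (rule mult_right_mono[rotated])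
  then have "1 \<le> l * gap_const" using K(2) by (simp add: mult.commute)
  then show ?thesis using gap_const_ge(1) by (simp add: divide_le_eq)
qed

section \<open>The hard demands and their potentials\<close>

definition double_potential :: "nat set \<Rightarrow> nat \<Rightarrow> real" where
  "double_potential S a = (if a div 2 \<in> nodes
    then (if even a then potential S (a div 2) else - potential S (a div 2)) else 0)"

definition double_demand :: "nat set \<Rightarrow> nat \<Rightarrow> real" where
  "double_demand S a = (if a div 2 \<in> level D
    then (if even a then coin_sign S (a div 2) else - coin_sign S (a div 2)) else 0)"

lemma graph_lap_double_potential: "graph_lap F (double_potential S) a = double_demand S a"
proof -
  define w where "w = a div 2"
  have a: "a = 2 * w \<or> a = 2 * w + 1" unfolding w_def by presburger
  show ?thesis
  proof (cases "w \<in> nodes")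
    case True
    have nb: "v \<in> nodes" if "v \<in> heap_arcs `` {w}" for v using that heap_arcs_subset by auto
    have e: "graph_lap heap_arcs (\<lambda>v. double_potential S (2 * v)) w = graph_lap heap_arcs (potential S) w"
      "graph_lap heap_arcs (\<lambda>v. double_potential S (2 * v + 1)) w = - graph_lap heap_arcs (potential S) w"
      unfolding graph_lap_def sum_negf [symmetric]
      using nb True by (auto intro!: sum.cong simp: double_potential_def)
    have g: "graph_lap heap_arcs (potential S) w = (if w \<in> level D then coin_sign S w else 0)
        - (if w \<in> roots then 2 * potential S w else 0)"
      using grounded_potential[OF True, of S] by (simp add: grounded_def)
    have v: "double_potential S (2 * w) = potential S w" "double_potential S (2 * w + 1) = - potential S w"
      using True by (auto simp: double_potential_def)
    have "graph_lap F (double_potential S) (2 * w) = (if w \<in> level D then coin_sign S w else 0)"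
      "graph_lap F (double_potential S) (2 * w + 1) = - (if w \<in> level D then coin_sign S w else 0)"
      unfolding graph_lap_double[OF finite_heap_nbrs] e g v by auto
    then show ?thesis using a by (auto simp: double_demand_def)
  next
    case False
    then have "w \<notin> roots" "w \<notin> level D" using roots_nodes leaf_nodes by auto
    then have "graph_lap F (double_potential S) (2 * w) = 0" "graph_lap F (double_potential S) (2 * w + 1) = 0"
      unfolding graph_lap_double[OF finite_heap_nbrs] graph_lap_heap_outside[OF False] by auto
    then show ?thesis using a \<open>w \<notin> level D\<close> by (auto simp: double_demand_def)
  qed
qed

text \<open>The bias \<open>80 * D^3 / 2^D\<close> makes the mean potential of a root
  \<open>40 * D^3\<close>, twice the noise level, and every mean potential at most
  \<open>120 * D^3\<close>. Hence the drop across the root edge exceeds \<open>2 * 20 * D^3\<close>,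
  whereas the permitted error is at most a quarter of \<open>140 * D^3\<close>, that is
  \<open>35 * D^3\<close>. The condition on \<open>2 ^ D\<close> keeps the bias at most 1.\<close>

lemma double_heap_probe_lower_bound:
  assumes D: "2 \<le> D" "80 * real D ^ 3 \<le> 2 ^ D" and n: "4 * 4 ^ D \<le> n"
    and \<epsilon>: "0 < \<epsilon>" "\<epsilon> \<le> 1 / 4"
    and R: "prob_space R" "solves_difference (laplacian (star_plus n F)) (2 * 2 ^ D) (2 * 2 ^ D + 1) \<epsilon> R"
      "worst_case_probes_le (laplacian (star_plus n F)) R q"
  shows "1 / 36 \<le> real q * (80 * real D ^ 3 / 2 ^ D)\<^sup>2"
proof -
  interpret far_arcs n F using D(1) n by (rule far_arcs_double)
  let ?\<delta> = "80 * real D ^ 3 / 2 ^ D" and ?u = "2 * 2 ^ D :: nat"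
  have root: "2 ^ D \<in> roots" by (simp add: roots_def)
  then have node: "2 ^ D \<in> nodes" using roots_nodes by blast
  have un: "?u < n" "?u + 1 < n"
    using node_code_range(2)[OF D(1), of "?u + 1"] node n by auto
  have \<delta>: "0 \<le> ?\<delta>" "?\<delta> \<le> 1" using D by (auto simp: divide_le_eq)
  have \<delta>_mean: "?\<delta> * (3 / 2 * 2 ^ D) = 120 * real D ^ 3" "?\<delta> * (2 ^ D / 2) = 40 * real D ^ 3" by auto
  have lap: "laplacian (star_plus n F) *\<^sub>v vec n (double_potential S) = vec n (double_demand S)" for S
  proof (rule eq_vecI)
    fix i assume "i < dim_vec (vec n (double_demand S))"
    then have i: "i < n" by simp
    have "graph_lap (star_arcs \<union> F) (double_potential S) i = double_demand S i"
    proof (cases "5 \<le> i")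
      case True
      then show ?thesis by (simp add: lap_star_far graph_lap_double_potential)
    next
      case False
      have small: "double_potential S a = 0" "double_demand S a = 0" if "a < 5" for a
        using node_code_range(1)[OF D(1), of a] leaf_nodes that
        by (auto simp: double_potential_def double_demand_def)
      have "b < 5" if "b \<in> (star_arcs \<union> F) `` {i}" for b
        using that False F(1) by (auto simp: star_arcs_def)
      then show ?thesis using False small by (simp add: graph_lap_def)
    qed
    then show "(laplacian (star_plus n F) *\<^sub>v vec n (double_potential S)) $ i = vec n (double_demand S) $ i"
      using i parcs_subset laplacian_mult_vec[of "star_plus n F" n i] by simp
  qed (use laplacian_carrier[of "star_plus n F" n] in auto)
  show ?thesis
  proof (rule antisymmetric_probe_lower_bound[OF R _ un _ \<delta> _ near_mean_weight[OF D(1)] lap])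
    show "laplacian (star_plus n F) \<in> carrier_mat n n" by (rule laplacian_carrier) simp
    show "finite (level D)" by (simp add: level_def)
    show "near_mean ?\<delta> \<subseteq> Pow (level D)" by (auto simp: near_mean_def)
    show "\<bar>?\<delta>\<bar> \<le> 1" using \<delta> by simp
    show "double_demand S i = double_demand S' i" if "i div 2 \<in> S \<longleftrightarrow> i div 2 \<in> S'" for i S S'
      using that by (simp add: double_demand_def coin_sign_def)
    show "double_potential (level D - S) i = - double_potential S i" for S i
      by (simp add: double_potential_def potential_compl)
    show "\<epsilon> * linf_norm (vec n (double_potential S)) < double_potential S ?u - double_potential S (?u + 1)"
      if "S \<in> near_mean ?\<delta>" for S
    proof -
      have near: "\<bar>potential S w - ?\<delta> * mean_potential w\<bar> < 20 * real D ^ 3" if "w \<in> nodes" for w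
        using that \<open>S \<in> near_mean ?\<delta>\<close> by (auto simp: near_mean_def)
      have "\<bar>potential S w\<bar> \<le> 140 * real D ^ 3" if w: "w \<in> nodes" for w
      proof -
        have "?\<delta> * mean_potential w \<le> ?\<delta> * (3 / 2 * 2 ^ D)" "0 \<le> ?\<delta> * mean_potential w"
          using mean_potential_bounds[OF w] \<delta>(1) by (intro mult_left_mono mult_nonneg_nonneg; simp)+
        then show ?thesis using near[OF w] \<delta>_mean(1) by linarith
      qed
      then have bound: "\<bar>double_potential S a\<bar> \<le> 140 * real D ^ 3" for a
        by (simp add: double_potential_def)
      have "linf_norm (vec n (double_potential S)) \<le> 140 * real D ^ 3"
        unfolding linf_norm_def using bound n5 by (subst Max_le_iff) auto
      then have "\<epsilon> * linf_norm (vec n (double_potential S)) \<le> \<epsilon> * (140 * real D ^ 3)"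
        using \<epsilon>(1) by (intro mult_left_mono) auto
      also have "\<dots> \<le> 1 / 4 * (140 * real D ^ 3)"
        using \<epsilon>(2) by (intro mult_right_mono) auto
      finally have "\<epsilon> * linf_norm (vec n (double_potential S)) \<le> 1 / 4 * (140 * real D ^ 3)" .
      moreover have "20 * real D ^ 3 < potential S (2 ^ D)"
        using near[OF node] unfolding mean_potential_root[OF root] \<delta>_mean(2) by linarith
      moreover have "double_potential S ?u - double_potential S (?u + 1) = 2 * potential S (2 ^ D)"
        using node by (simp add: double_potential_def)
      moreover have "0 \<le> real D ^ 3" by simp
      ultimately show ?thesis by linarith
    qed
  qed
qed

end

section \<open>The lower bound\<close>

text \<open>One coin of bias 1 at the centre of the star: a tree that reads nothing answers alike
  for both signs.\<close>

lemma star_probe_lower_bound: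
  assumes n: "5 \<le> n" and \<epsilon>: "0 < \<epsilon>" "\<epsilon> < 1"
    and R: "prob_space R" "solves_difference (laplacian (star_plus n {})) 0 1 \<epsilon> R"
      "worst_case_probes_le (laplacian (star_plus n {})) R q"
  shows "1 \<le> q"
proof -
  interpret far_arcs n "{}" using n by unfold_locales (auto simp: sym_def irrefl_def)
  define f :: "nat set \<Rightarrow> nat \<Rightarrow> real" where "f S a = (if a = 0 then coin_sign S 0 else 0)" for S a
  have "1 / 36 \<le> real q * 1\<^sup>2"
  proof (rule antisymmetric_probe_lower_bound[OF R, where n = n and X = "{0}" and good = "{{0}}" and f = f
        and g = "\<lambda>S. graph_lap star_arcs (f S)" and \<pi> = "\<lambda>_. 0"])
    show "laplacian (star_plus n {}) \<in> carrier_mat n n" by (rule laplacian_carrier) simp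
    show "laplacian (star_plus n {}) *\<^sub>v vec n (f S) = vec n (graph_lap star_arcs (f S))" for S
      using laplacian_mult_vec[of "star_plus n {}" n _ "f S"] parcs_subset
        laplacian_carrier[of "star_plus n {}" n]
      by (intro eq_vecI) auto
    show "graph_lap star_arcs (f S) i = graph_lap star_arcs (f S') i" if "0 \<in> S \<longleftrightarrow> 0 \<in> S'" for i S S'
    proof -
      have "f S = f S'" using that by (auto simp: f_def coin_sign_def)
      then show ?thesis by simp
    qed
    show "f ({0} - S) i = - f S i" for S i by (simp add: f_def coin_sign_def)
    show "\<epsilon> * linf_norm (vec n (f S)) < f S 0 - f S 1" if "S \<in> {{0}}" for S
    proof -
      have "linf_norm (vec n (f S)) \<le> 1"
        unfolding linf_norm_def using n by (subst Max_le_iff) (auto simp: f_def coin_sign_def)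
      then have "\<epsilon> * linf_norm (vec n (f S)) \<le> \<epsilon> * 1" using \<epsilon> by (intro mult_left_mono) auto
      moreover have "f S 0 - f S 1 = 1" using that by (simp add: f_def coin_sign_def)
      ultimately show ?thesis using \<epsilon> by linarith
    qed
  qed (use n in \<open>auto simp: coin_weight_def coin_sign_def\<close>)
  then show ?thesis by (cases q) auto
qed

text \<open>The starting point is sharp: at \<open>D = 19\<close> the inequality fails.\<close>

lemma cube_le_two_power: "20 \<le> D \<Longrightarrow> 80 * D ^ 3 \<le> (2::nat) ^ D"
proof (induction D rule: dec_induct)
  case (step D)
  have "(D + 1) ^ 3 = D ^ 3 + 3 * D ^ 2 + 3 * D + 1"
    by (simp add: power2_eq_square power3_eq_cube algebra_simps)
  also have "\<dots> \<le> D ^ 3 + 7 * (D * D)"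
    using step.hyps(1) mult_le_mono1[OF step.hyps(1), of D] unfolding power2_eq_square by linarith
  also have "\<dots> \<le> 2 * D ^ 3"
    using step.hyps(1) unfolding power3_eq_cube by simp
  finally show ?case using step.IH by simp
qed simp

text \<open>The left bound keeps the condition number of order \<open>k\<close>; the right bound
  makes \<open>4 ^ D\<close> comparable to \<open>k^2\<close> up to powers of
  \<open>D\<close>.\<close>

lemma ex_tight_exponent:
  fixes k :: real
  assumes "1 \<le> k"
  shows "\<exists>D. (real D + 1)\<^sup>2 * 2 ^ D \<le> k \<and> k < (real D + 2)\<^sup>2 * 2 ^ (D + 1)"
proof -
  define P where "P D \<longleftrightarrow> k < (real D + 1)\<^sup>2 * 2 ^ D" for D :: nat
  obtain m :: nat where m: "k < 2 ^ m" using real_arch_pow[of 2 k] by auto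
  have "1 * (2::real) ^ m \<le> (real m + 1)\<^sup>2 * 2 ^ m" by (intro mult_right_mono) auto
  then have "P m" using m unfolding P_def by linarith
  moreover have "\<not> P 0" using assms by (simp add: P_def)
  ultimately obtain D where "\<not> P D" "P (Suc D)"
    using ex_least_nat_less[of P m] by auto
  then show ?thesis by (intro exI[of _ D]) (simp add: P_def add.commute)
qed

theorem theorem1p3:
  shows "\<forall>C>0. \<exists>(K::real) (a\<^sub>1::real) (a\<^sub>2::real) (c::real) (d::nat) (N::nat).
    K > 0 \<and> 0 < a\<^sub>1 \<and> 0 < a\<^sub>2 \<and> 0 < c \<and>
    (\<forall>n\<ge>N. \<forall>k::real. 1 \<le> k \<and> k \<le> C * (sqrt (real n) / ln (real n)) \<longrightarrow>
      (\<exists>(G :: nat pair_pre_digraph) u v.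
        pair_graph G \<and> pverts G = {0..<n} \<and> max_degree G = 4 \<and>
        condition_number (laplacian G) \<le> K * k \<and>
        (u, v) \<in> parcs G \<and>
        (\<exists>\<epsilon>::real. a\<^sub>1 / ln (real n) \<le> \<epsilon> \<and> \<epsilon> \<le> a\<^sub>2 / ln (real n) \<and>
          (\<forall>R :: probe_alg measure. prob_space R \<and> solves_difference (laplacian G) u v \<epsilon> R \<longrightarrow>
            (\<forall>q. worst_case_probes_le (laplacian G) R q \<longrightarrow>
               real q \<ge> c * k\<^sup>2 / ln (real n) ^ d)))))"
proof (intro allI impI, goal_cases)
  case (1 C)
  define k0 :: real where "k0 = 21\<^sup>2 * 2 ^ 20"
  define c where "c = 1 / k0\<^sup>2"
  have k0: "k0 > 0" by (simp add: k0_def)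
  have c0: "0 < c" using k0 by (simp add: c_def)
  \<comment> \<open>\<open>4 \<le> ln n\<close> ensures \<open>\<epsilon> \<le> 1 / 4\<close>, and
    \<open>2 * C \<le> ln n\<close> ensures \<open>2 ^ D \<le> sqrt n / 2\<close>, which is room for
    two heaps.\<close>
  define N where "N = nat \<lceil>exp (max 4 (2 * C))\<rceil>"
  have main: "\<exists>(G :: nat pair_pre_digraph) u v.
        pair_graph G \<and> pverts G = {0..<n} \<and> max_degree G = 4 \<and>
        condition_number (laplacian G) \<le> 128 * k \<and>
        (u, v) \<in> parcs G \<and>
        (\<exists>\<epsilon>::real. 1 / ln (real n) \<le> \<epsilon> \<and> \<epsilon> \<le> 1 / ln (real n) \<and>
          (\<forall>R :: probe_alg measure. prob_space R \<and> solves_difference (laplacian G) u v \<epsilon> R \<longrightarrow>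
            (\<forall>q. worst_case_probes_le (laplacian G) R q \<longrightarrow>
               real q \<ge> c * k\<^sup>2 / ln (real n) ^ 10)))"
    if nN: "n \<ge> N" and k: "1 \<le> k" "k \<le> C * (sqrt (real n) / ln (real n))" for n :: nat and k :: real
  proof -
    have expn: "exp (max 4 (2 * C)) \<le> real n"
      using nN unfolding N_def by linarith
    then have n0: "0 < real n" using exp_gt_zero[of "max 4 (2 * C)"] by linarith
    have lnn: "max 4 (2 * C) \<le> ln (real n)"
      using ln_ge_iff[OF n0, of "max 4 (2 * C)"] expn by blast
    have "5 \<le> exp (4::real)" using exp_ge_add_one_self[of 4] by simp
    also have "\<dots> \<le> exp (max 4 (2 * C))" by simp
    finally have n5: "5 \<le> n" using expn by linarith
    define \<epsilon> where "\<epsilon> = 1 / ln (real n)"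
    have \<epsilon>: "0 < \<epsilon>" "\<epsilon> \<le> 1 / 4" using lnn by (auto simp: \<epsilon>_def divide_simps)
    obtain D where D: "(real D + 1)\<^sup>2 * 2 ^ D \<le> k" "k < (real D + 2)\<^sup>2 * 2 ^ (D + 1)"
      using ex_tight_exponent[OF k(1)] by blast
    show ?thesis
    \<comment> \<open>Below 20 the bias \<open>80 * D^3 / 2^D\<close> need not be at most 1. There
      \<open>k < k0\<close>, and with \<open>c = 1 / k0^2\<close> it is enough to force a single
      probe on the star alone.\<close>
    proof (cases "D < 20")
      case True
      have "k < (real D + 2)\<^sup>2 * 2 ^ (D + 1)" by (rule D(2))
      also have "\<dots> \<le> k0"
        unfolding k0_def using True by (intro mult_mono power_mono power_increasing) auto
      finally have "k\<^sup>2 \<le> k0\<^sup>2" using k(1) by (intro power_mono) auto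
      then have ck: "c * k\<^sup>2 \<le> 1" using k0 by (simp add: c_def)
      have "1 \<le> ln (real n) ^ 10" using lnn by (intro one_le_power) auto
      then have "c * k\<^sup>2 / ln (real n) ^ 10 \<le> 1" using ck by (simp add: divide_le_eq)
      moreover interpret far_arcs n "{}" using n5 by unfold_locales (auto simp: sym_def irrefl_def)
      have "condition_number (laplacian (star_plus n {})) \<le> 8 * 1"
        by (rule condition_number_star) (auto simp: graph_lap_def)
      moreover have "(0, 1) \<in> parcs (star_plus n {})" by (simp add: star_arcs_def)
      moreover have "1 \<le> q" if "prob_space R" "solves_difference (laplacian (star_plus n {})) 0 1 \<epsilon> R"
        "worst_case_probes_le (laplacian (star_plus n {})) R q" for R q
        using star_probe_lower_bound[OF n5 _ _ that] \<epsilon> by simp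
      ultimately show ?thesis
        using k(1) pair_graph_star max_degree_star
        by (intro exI[of _ "star_plus n {}"] exI[of _ "0::nat"] exI[of _ "1::nat"] exI[of _ \<epsilon>] conjI)
          (auto simp: \<epsilon>_def intro: order_trans)
    next
      case False
      then have D20: "20 \<le> D" by simp
      interpret heap: shuffle_heap D using D20 by unfold_locales simp
      have cube: "80 * real D ^ 3 \<le> 2 ^ D"
        using of_nat_mono[OF cube_le_two_power[OF D20], where 'a = real] by simp
      have "1 * (2::real) ^ D \<le> (real D + 1)\<^sup>2 * 2 ^ D" by (intro mult_right_mono) auto
      then have "2 ^ D \<le> C * (sqrt (real n) / ln (real n))" using D(1) k by linarith
      also have "\<dots> \<le> sqrt (real n) / 2"
      proof -
        have "C * sqrt (real n) * 2 \<le> ln (real n) * sqrt (real n)"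
          using mult_right_mono[of "2 * C" "ln (real n)" "sqrt (real n)"] lnn by (simp add: mult_ac)
        then show ?thesis using lnn by (simp add: divide_le_eq mult_ac)
      qed
      finally have "(2 ^ D)\<^sup>2 \<le> (sqrt (real n) / 2)\<^sup>2" by (intro power_mono) auto
      moreover have pow4: "((2::real) ^ D)\<^sup>2 = 4 ^ D"
        by (metis mult_2 numeral_Bit0 numeral_eq_iff power2_eq_square power_commutes power_mult_distrib
            numeral_times_numeral num_double)
      ultimately have n4: "4 * 4 ^ D \<le> real n" by (simp add: power_divide)
      then have n4': "4 * 4 ^ D \<le> n"
        by (metis of_nat_le_iff of_nat_mult of_nat_numeral of_nat_power)
      have Dln: "real D \<le> ln (real n)"
      proof -
        have "exp (real D) = exp 1 ^ D" by (simp add: exp_of_nat_mult [symmetric])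
        also have "\<dots> \<le> 4 ^ D" using exp_le by (intro power_mono) auto
        also have "\<dots> \<le> real n" using n4 by (rule order_trans[rotated]) simp
        finally show ?thesis using n0 by (simp add: ln_ge_iff)
      qed
      interpret far_arcs n heap.F using D20 n4' by (intro heap.far_arcs_double) auto
      \<comment> \<open>Here \<open>8 * heap.gap_const = 128 * (D + 1)^2 * 2 ^ D\<close>, the origin
        of the witness 128.\<close>
      have "condition_number (laplacian (star_plus n heap.F)) \<le> 8 * heap.gap_const"
        using D20 n4' by (intro condition_number_star heap.gap_const_ge heap.spectral_gap_double) auto
      also have "\<dots> \<le> 128 * k" using D(1) by (simp add: heap.gap_const_def)
      finally have cond: "condition_number (laplacian (star_plus n heap.F)) \<le> 128 * k" .
      have "(2 * 2 ^ D, 2 * 2 ^ D + 1) \<in> heap.F"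
        by (simp add: double_arcs_def heap.roots_def)
      then have edge: "(2 * 2 ^ D, 2 * 2 ^ D + 1) \<in> parcs (star_plus n heap.F)" by simp
      have bound: "c * k\<^sup>2 / ln (real n) ^ 10 \<le> real q"
        if "prob_space R" "solves_difference (laplacian (star_plus n heap.F)) (2 * 2 ^ D) (2 * 2 ^ D + 1) \<epsilon> R"
          "worst_case_probes_le (laplacian (star_plus n heap.F)) R q" for R q
      proof -
        have "1 / 36 \<le> real q * (80 * real D ^ 3 / 2 ^ D)\<^sup>2"
          using D20 cube n4' \<epsilon> that by (intro heap.double_heap_probe_lower_bound) auto
        also have "(80 * real D ^ 3 / 2 ^ D)\<^sup>2 = 6400 * real D ^ 6 / 4 ^ D"
          unfolding power_divide pow4 by (simp add: power_mult_distrib power_mult [symmetric])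
        finally have q: "4 ^ D \<le> 230400 * (real q * real D ^ 6)" by (simp add: field_simps)
        \<comment> \<open>The exponent 10 of the logarithm is 4 + 6: \<open>k^2\<close> exceeds
          \<open>4 ^ D\<close> by a factor of order \<open>D^4\<close>, and the square of the bias
          contributes \<open>D^6\<close>.\<close>
        have "k\<^sup>2 \<le> ((real D + 2)\<^sup>2 * 2 ^ (D + 1))\<^sup>2"
          using D(2) k(1) by (intro power_mono) auto
        also have "\<dots> \<le> ((2 * real D)\<^sup>2 * 2 ^ (D + 1))\<^sup>2"
          using D20 by (intro power_mono mult_right_mono) auto
        also have "\<dots> = 64 * real D ^ 4 * (2 ^ D)\<^sup>2"
          by (simp add: power_mult_distrib power_mult [symmetric])
        also have "\<dots> \<le> 64 * real D ^ 4 * (230400 * (real q * real D ^ 6))"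
          unfolding pow4 using q by (intro mult_left_mono) auto
        also have "\<dots> = 14745600 * real q * real D ^ 10"
          by (simp add: power_add [symmetric])
        also have "\<dots> \<le> k0\<^sup>2 * real q * ln (real n) ^ 10"
          using Dln by (intro mult_mono power_mono) (auto simp: k0_def)
        finally have "c * k\<^sup>2 \<le> real q * ln (real n) ^ 10"
          using k0 by (simp add: c_def divide_le_eq mult_ac)
        then show ?thesis using lnn by (simp add: divide_le_eq)
      qed
      show ?thesis
        using cond edge bound pair_graph_star max_degree_star
        by (intro exI[of _ "star_plus n heap.F"] exI[of _ "2 * 2 ^ D :: nat"] exI[of _ "2 * 2 ^ D + 1 :: nat"]
            exI[of _ \<epsilon>] conjI)
          (auto simp: \<epsilon>_def)
    qed
  qed
  show ?case
    by (rule exI[of _ 128], rule exI[of _ 1], rule exI[of _ 1], rule exI[of _ c], rule exI[of _ 10],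
        rule exI[of _ N]) (use c0 main in simp)
qed

end
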